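(* Let $\mathcal{V}$ be a complex vector space, $\Omega\subset\mathcal{V}_{\rm nc}$ a finite set of nc points, $\mathcal{Y}$ a Hilbert space, $\mathcal{A}$ a unital $C^*$-algebra and $\mathbb{S}\subset\mathcal{A}$ an operator system (a unital $*$-closed linear subspace). Let $K$ be a completely positive nc kernel on $\Omega$ with values in $\mathcal{L}(\mathbb{S}_{\rm nc},\mathcal{L}(\mathcal{Y})_{\rm nc})$. Then there exists a completely positive nc kernel $\widehat K$ on $\Omega$ with values in $\mathcal{L}(\mathcal{A}_{\rm nc},\mathcal{L}(\mathcal{Y})_{\rm nc})$ such that $\widehat K(Z,W)(P)=K(Z,W)(P)$ for all $Z\in\Omega_n$, $W\in\Omega_m$, $n,m\in\mathbb{N}$, whenever $P\in\mathbb{S}^{n\times m}$.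
   Context: $\mathcal{V}_{\rm nc}=\amalg_{n\ge1}\mathcal{V}^{n\times n}$; $\Omega_n=\Omega\cap\mathcal{V}^{n\times n}$; complex matrices act on matrices over $\mathcal{V}$, $\mathcal{A}$, $\mathbb{S}$, $\mathcal{L}(\mathcal{Y})$ by matrix multiplication. For $\mathbb{X}=\mathcal{A}$ or $\mathbb{X}=\mathbb{S}$, a nc kernel on $\Omega$ with values in $\mathcal{L}(\mathbb{X}_{\rm nc},\mathcal{L}(\mathcal{Y})_{\rm nc})$ is a function $K$ on $\Omega\times\Omega$ such that (graded) $K(Z,W)$ is a linear map $\mathbb{X}^{n\times m}\to\mathcal{L}(\mathcal{Y})^{n\times m}$ for $Z\in\Omega_n$, $W\in\Omega_m$; and (respects intertwinings) whenever $Z\in\Omega_n$, $\widetilde Z\in\Omega_{\tilde n}$, $\alpha\in\mathbb{C}^{\tilde n\times n}$, $\alpha Z=\widetilde Z\alpha$, $W\in\Omega_m$, $\widetilde W\in\Omega_{\tilde m}$, $\beta\in\mathbb{C}^{\tilde m\times m}$, $\beta W=\widetilde W\beta$, $P\in\mathbb{X}^{n\times m}$, then $\alpha K(Z,W)(P)\beta^*=K(\widetilde Z,\widetilde W)(\alpha P\beta^* )$. Such a $K$ is completely positive (cp) if for all finite lists $Z_1,\dots,Z_k$ in $\Omega$, $Z_i\in\Omega_{n_i}$, the map $[P_{ij}]\mapsto[K(Z_i,Z_j)(P_{ij})]$ ($P_{ij}\in\mathbb{X}^{n_i\times n_j}$) from $\mathbb{X}^{N\times N}\subset\mathcal{A}^{N\times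 N}$ to $\mathcal{L}(\mathcal{Y})^{N\times N}\cong\mathcal{L}(\mathcal{Y}^N)$, $N=\sum n_i$, is completely positive. *)

theory Defs
  imports
    Complex_Main
    "HOL-Library.Nonpos_Ints"
    "Jordan_Normal_Form.Matrix"
begin

section \<open>Complex vector spaces, Hilbert spaces and C*-algebras\<close>

class complex_vector = ab_group_add +
  fixes scaleC :: "complex \<Rightarrow> 'a \<Rightarrow> 'a"  (infixr \<open>*\<^sub>C\<close> 75)
  assumes scaleC_add_right: "a *\<^sub>C (x + y) = a *\<^sub>C x + a *\<^sub>C y"
    and scaleC_add_left: "(a + b) *\<^sub>C x = a *\<^sub>C x + b *\<^sub>C x"
    and scaleC_scaleC: "a *\<^sub>C (b *\<^sub>C x) = (a * b) *\<^sub>C x"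
    and scaleC_one: "1 *\<^sub>C x = x"

class complex_normed_vector = complex_vector + real_normed_vector +
  assumes scaleR_scaleC: "r *\<^sub>R x = complex_of_real r *\<^sub>C x"
    and norm_scaleC: "norm (a *\<^sub>C x) = cmod a * norm x"

text \<open>The inner product is linear in the first argument.  Positive definiteness is part of the
  last axiom, since the norm is already known to be one.\<close>

class complex_inner = complex_normed_vector +
  fixes cinner :: "'a \<Rightarrow> 'a \<Rightarrow> complex"
  assumes cinner_commute: "cinner x y = cnj (cinner y x)"
    and cinner_add_left: "cinner (x + y) z = cinner x z + cinner y z"
    and cinner_scaleC_left: "cinner (a *\<^sub>C x) y = a * cinner x y"
    and cinner_self: "cinner x x = complex_of_real ((norm x)\<^sup>2)"

class chilbert_space = complex_inner + banach

text \<open>As usual for unital normed algebras, the unit has norm one, so the algebra is nonzero.\<close>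

class unital_cstar_algebra = complex_normed_vector + real_normed_algebra_1 + banach +
  fixes adj :: "'a \<Rightarrow> 'a"
  assumes mult_scaleC_left: "(a *\<^sub>C x) * y = a *\<^sub>C (x * y)"
    and mult_scaleC_right: "x * (a *\<^sub>C y) = a *\<^sub>C (x * y)"
    and adj_adj: "adj (adj x) = x"
    and adj_add: "adj (x + y) = adj x + adj y"
    and adj_scaleC: "adj (a *\<^sub>C x) = cnj a *\<^sub>C adj x"
    and adj_mult: "adj (x * y) = adj y * adj x"
    and cstar_identity: "norm (adj x * x) = (norm x)\<^sup>2"

definition operator_system :: "'a::unital_cstar_algebra set \<Rightarrow> bool" where
  "operator_system S \<longleftrightarrow>
     1 \<in> S \<and> (\<forall>x\<in>S. \<forall>y\<in>S. x + y \<in> S) \<and> (\<forall>c. \<forall>x\<in>S. c *\<^sub>C x \<in> S) \<and> (\<forall>x\<in>S. adj x \<in> S)"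


section \<open>Bounded operators\<close>

lemma scaleC_zero_right [simp]: "a *\<^sub>C (0::'a::complex_vector) = 0"
  using scaleC_add_right[of a 0 0] by simp

lemma scaleC_minus_right: "a *\<^sub>C (- x) = - (a *\<^sub>C (x::'a::complex_vector))"
  using scaleC_add_right[of a x "- x"] by (simp add: add_eq_0_iff)

lemma scaleC_diff_right: "a *\<^sub>C (x - y) = a *\<^sub>C x - a *\<^sub>C (y::'a::complex_vector)"
  using scaleC_add_right[of a x "- y"] by (simp add: scaleC_minus_right)

lemma scaleC_commute: "a *\<^sub>C b *\<^sub>C x = b *\<^sub>C a *\<^sub>C (x::'a::complex_vector)"
  by (simp add: scaleC_scaleC mult.commute)

lemma bounded_linear_scaleC: "bounded_linear (\<lambda>x::'a::complex_normed_vector. a *\<^sub>C x)"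
  by (rule bounded_linear_intro[where K = "cmod a"])
    (simp_all add: scaleC_add_right scaleR_scaleC scaleC_commute norm_scaleC)

typedef (overloaded) 'y bop =
  "{T :: 'y::complex_normed_vector \<Rightarrow> 'y. bounded_linear T \<and> (\<forall>c x. T (c *\<^sub>C x) = c *\<^sub>C T x)}"
  morphisms bop_apply Bop
  by (rule exI[of _ "\<lambda>_. 0"]) simp

setup_lifting type_definition_bop

instantiation bop :: (complex_normed_vector) complex_vector
begin

lift_definition zero_bop :: "'a bop" is "\<lambda>_. 0" by simp

lift_definition plus_bop :: "'a bop \<Rightarrow> 'a bop \<Rightarrow> 'a bop" is "\<lambda>S T x. S x + T x"
  by (simp add: bounded_linear_add scaleC_add_right)

lift_definition uminus_bop :: "'a bop \<Rightarrow> 'a bop" is "\<lambda>T x. - T x"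
  by (simp add: bounded_linear_minus scaleC_minus_right)

lift_definition minus_bop :: "'a bop \<Rightarrow> 'a bop \<Rightarrow> 'a bop" is "\<lambda>S T x. S x - T x"
  by (simp add: bounded_linear_sub scaleC_diff_right)

lift_definition scaleC_bop :: "complex \<Rightarrow> 'a bop \<Rightarrow> 'a bop" is "\<lambda>a T x. a *\<^sub>C T x"
  by (simp add: bounded_linear_compose[OF bounded_linear_scaleC] scaleC_commute)

instance
  by standard
    (transfer; simp add: fun_eq_iff algebra_simps scaleC_add_right scaleC_add_left
      scaleC_scaleC scaleC_one)+

end


section \<open>Matrices over a vector space\<close>

definition lact :: "complex mat \<Rightarrow> 'v::complex_vector mat \<Rightarrow> 'v mat"  (infixr \<open>*\<^sub>l\<close> 71) where
  "\<alpha> *\<^sub>l Z = mat (dim_row \<alpha>) (dim_col Z)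
     (\<lambda>(i, j). \<Sum>k<dim_col \<alpha>. (\<alpha> $$ (i, k)) *\<^sub>C (Z $$ (k, j)))"

definition ract :: "'v::complex_vector mat \<Rightarrow> complex mat \<Rightarrow> 'v mat"  (infixl \<open>*\<^sub>r\<close> 70) where
  "Z *\<^sub>r \<beta> = mat (dim_row Z) (dim_col \<beta>)
     (\<lambda>(i, j). \<Sum>k<dim_row \<beta>. (\<beta> $$ (k, j)) *\<^sub>C (Z $$ (i, k)))"

definition ctranspose :: "complex mat \<Rightarrow> complex mat" where
  "ctranspose \<beta> = map_mat cnj (transpose_mat \<beta>)"

definition mats :: "'x set \<Rightarrow> nat \<Rightarrow> nat \<Rightarrow> 'x mat set" where
  "mats X n m = {P \<in> carrier_mat n m. elements_mat P \<subseteq> X}"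

definition nc_space :: "'v::complex_vector mat set" where
  "nc_space = (\<Union>n\<in>{1..}. carrier_mat n n)"


section \<open>Completely positive maps\<close>

definition pos_alg_mat :: "nat \<Rightarrow> 'a::unital_cstar_algebra mat \<Rightarrow> bool" where
  "pos_alg_mat N P \<longleftrightarrow> (\<exists>B \<in> carrier_mat N N. P = map_mat adj (transpose_mat B) * B)"

text \<open>Positivity of the operator on the Hilbert space of column vectors of length \<open>N\<close>
  given by an operator matrix.\<close>

definition pos_op_mat :: "nat \<Rightarrow> 'y::chilbert_space bop mat \<Rightarrow> bool" where
  "pos_op_mat N T \<longleftrightarrow> T \<in> carrier_mat N N \<and>
     (\<forall>y \<in> carrier_vec N.
        (\<Sum>i<N. cinner (\<Sum>j<N. bop_apply (T $$ (i, j)) (y $ j)) (y $ i)) \<in> \<real>\<^sub>\<ge>\<^sub>0)"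

text \<open>For block sizes \<open>ns\<close>, the \<open>i\<close>-th block occupies the indices from
  \<open>offset ns i\<close> up to \<open>offset ns (Suc i) - 1\<close>.\<close>

definition offset :: "nat list \<Rightarrow> nat \<Rightarrow> nat" where
  "offset ns i = sum_list (take i ns)"

definition block_index :: "nat list \<Rightarrow> nat \<Rightarrow> nat" where
  "block_index ns a = (LEAST i. a < offset ns (Suc i))"

definition block_pos :: "nat list \<Rightarrow> nat \<Rightarrow> nat" where
  "block_pos ns a = a - offset ns (block_index ns a)"

definition block :: "nat list \<Rightarrow> 'x mat \<Rightarrow> nat \<Rightarrow> nat \<Rightarrow> 'x mat" where
  "block ns P i j = mat (ns ! i) (ns ! j) (\<lambda>(a, b). P $$ (offset ns i + a, offset ns j + b))"

text \<open>The map sending a block matrix with blocks \<open>P\<^sub>i\<^sub>j\<close> to the one with blocks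
  \<open>F i j P\<^sub>i\<^sub>j\<close>.\<close>

definition blockwise ::
    "nat list \<Rightarrow> (nat \<Rightarrow> nat \<Rightarrow> 'x mat \<Rightarrow> 'z mat) \<Rightarrow> 'x mat \<Rightarrow> 'z mat" where
  "blockwise ns F P = mat (sum_list ns) (sum_list ns)
     (\<lambda>(a, b). let i = block_index ns a; j = block_index ns b
        in F i j (block ns P i j) $$ (block_pos ns a, block_pos ns b))"

text \<open>Complete positivity of a map from \<open>N \<times> N\<close> matrices over \<open>X\<close> to \<open>N \<times> N\<close> operator
  matrices: every ampliation, applied to \<open>k \<times> k\<close> matrices over the \<open>N \<times> N\<close> matrices,
  preserves positivity.\<close>

definition cp_map ::
    "'a::unital_cstar_algebra set \<Rightarrow> nat \<Rightarrow> ('a mat \<Rightarrow> 'y::chilbert_space bop mat) \<Rightarrow> bool" where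
  "cp_map X N \<phi> \<longleftrightarrow>
     (\<forall>k\<ge>1. \<forall>P \<in> mats X (k * N) (k * N).
        pos_alg_mat (k * N) P \<longrightarrow>
        pos_op_mat (k * N) (blockwise (replicate k N) (\<lambda>_ _. \<phi>) P))"


section \<open>Completely positive noncommutative kernels\<close>

definition graded_linear ::
    "'x::complex_vector set \<Rightarrow> nat \<Rightarrow> nat \<Rightarrow> ('x mat \<Rightarrow> 'z::complex_vector mat) \<Rightarrow> bool" where
  "graded_linear X n m L \<longleftrightarrow>
     (\<forall>P \<in> mats X n m. L P \<in> carrier_mat n m) \<and>
     (\<forall>P \<in> mats X n m. \<forall>Q \<in> mats X n m. L (P + Q) = L P + L Q) \<and>
     (\<forall>c. \<forall>P \<in> mats X n m. L (map_mat (scaleC c) P) = map_mat (scaleC c) (L P))"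

definition nc_kernel ::
    "'v::complex_vector mat set \<Rightarrow> 'a::unital_cstar_algebra set \<Rightarrow>
     ('v mat \<Rightarrow> 'v mat \<Rightarrow> 'a mat \<Rightarrow> 'y::chilbert_space bop mat) \<Rightarrow> bool" where
  "nc_kernel \<Omega> X K \<longleftrightarrow>
     (\<forall>Z\<in>\<Omega>. \<forall>W\<in>\<Omega>. graded_linear X (dim_row Z) (dim_row W) (K Z W)) \<and>
     (\<forall>Z\<in>\<Omega>. \<forall>Z'\<in>\<Omega>. \<forall>\<alpha> \<in> carrier_mat (dim_row Z') (dim_row Z).
      \<forall>W\<in>\<Omega>. \<forall>W'\<in>\<Omega>. \<forall>\<beta> \<in> carrier_mat (dim_row W') (dim_row W).
      \<forall>P \<in> mats X (dim_row Z) (dim_row W).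
        \<alpha> *\<^sub>l Z = Z' *\<^sub>r \<alpha> \<longrightarrow> \<beta> *\<^sub>l W = W' *\<^sub>r \<beta> \<longrightarrow>
        \<alpha> *\<^sub>l K Z W P *\<^sub>r ctranspose \<beta> = K Z' W' (\<alpha> *\<^sub>l P *\<^sub>r ctranspose \<beta>))"

definition cp_nc_kernel ::
    "'v::complex_vector mat set \<Rightarrow> 'a::unital_cstar_algebra set \<Rightarrow>
     ('v mat \<Rightarrow> 'v mat \<Rightarrow> 'a mat \<Rightarrow> 'y::chilbert_space bop mat) \<Rightarrow> bool" where
  "cp_nc_kernel \<Omega> X K \<longleftrightarrow> nc_kernel \<Omega> X K \<and>
     (\<forall>Zs. set Zs \<subseteq> \<Omega> \<longrightarrow>
        cp_map X (sum_list (map dim_row Zs))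
          (blockwise (map dim_row Zs) (\<lambda>i j. K (Zs ! i) (Zs ! j))))"

end

theory Submission
  imports Defs "HOL-Analysis.Elementary_Metric_Spaces" "HOL-Library.Poly_Mapping"
begin

text \<open>Spread the kernel out into scalars: for indices \<open>i = (w, Z, p, q)\<close>, \<open>j = (u, W, p', q')\<close> and
  \<open>a \<in> S\<close> put \<open>T i j a = \<langle>(K(Z, W)(e\<^sub>q\<^sub>q\<^sub>' a))\<^sub>p\<^sub>p\<^sub>' u, w\<rangle>\<close>.  Complete positivity says that this is a positive
  functional on the finitely supported matrices over \<open>S\<close> indexed by all such \<open>i, j\<close>, for the cone generated by
  the matrices \<open>g(i)\<^sup>* g(j)\<close> with values in the algebra.  The scalar matrices majorise every selfadjoint
  matrix, so Krein's theorem extends the functional to the whole algebra, with no compactness argument.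

  The structure is preserved automatically.  Linearity in the vectors and the intertwining relations
  state that certain scalar combinations of the columns of \<open>T\<close> vanish at \<open>a = 1\<close>; these are
  null vectors of the positive form, and by the Cauchy--Schwarz inequality they stay null for every \<open>a\<close>.
  Riesz representation turns the extended scalars back into operators.\<close>

text \<open>An arbitrary positive extension has no reason to respect the vector variables or the
  intertwinings. The index set is therefore treated as a plain set: the functional is extended first
  and the structure is recovered afterwards. The recovery works because the squared length of a
  scalar combination of columns involves only values at \<open>1\<close>, and \<open>1\<close> lies
  in \<open>S\<close>, where the extension changes nothing. The same inequality gives continuity in
  the vectors: \<open>a * adj a\<close> is dominated by a multiple of \<open>1\<close>, and the
  diagonal values at \<open>1\<close> come from bounded operators. Since indices may repeat points,
  the ampliations of a list of points amount to finite families of indices, so complete positivity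
  of the new kernel is plain positivity of the extended functional.\<close>

lemma scaleC_zero_left [simp]: "0 *\<^sub>C (x::'a::complex_vector) = 0"
  using scaleC_add_left[of 0 0 x] by simp

lemma scaleC_minus_left: "(- a) *\<^sub>C (x::'a::complex_vector) = - (a *\<^sub>C x)"
  using scaleC_add_left[of a "- a" x] by (simp add: add_eq_0_iff)

lemma scaleC_sum_right: "a *\<^sub>C (\<Sum>i\<in>I. f i) = (\<Sum>i\<in>I. a *\<^sub>C (f i :: 'a::complex_vector))"
  by (induction I rule: infinite_finite_induct) (simp_all add: scaleC_add_right)

section \<open>Extension of positive functionals\<close>

text \<open>Homogeneity concerns positive real factors only: the Hahn--Banach argument uses the real
  structure of a complex space, and a complex functional is rebuilt from its real part
  afterwards.\<close>

definition sublinear :: "('b::complex_vector \<Rightarrow> real) \<Rightarrow> bool" where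
  "sublinear q \<longleftrightarrow> (\<forall>x y. q (x + y) \<le> q x + q y) \<and>
     (\<forall>t x. 0 < t \<longrightarrow> q (complex_of_real t *\<^sub>C x) = t * q x)"

lemma sublinear_zero: "sublinear q \<Longrightarrow> q (0::'a::complex_vector) = 0"
  unfolding sublinear_def using scaleC_zero_right[of 2] by (auto dest!: spec[of _ "2::real"] spec[of _ "0::'a"])

lemma sublinear_ge_minus: "sublinear q \<Longrightarrow> - q (- x) \<le> q x"
  using sublinear_zero[of q] unfolding sublinear_def by (auto dest!: spec2[of _ x "- x"])

lemma sublinear_scale:
  "sublinear q \<Longrightarrow> 0 \<le> t \<Longrightarrow> q (complex_of_real t *\<^sub>C x) = t * q x"
  by (cases "t = 0") (auto simp: sublinear_zero sublinear_def)

text \<open>Zorn's lemma yields a minimal sublinear functional; a minimal one agrees with all of its tilts below,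
  and the value of the tilt at \<open>t = 1\<close> then makes it additive.\<close>

lemma sublinear_tilt:
  assumes q: "sublinear q"
  defines "r \<equiv> \<lambda>a x. INF t\<in>{0..}. q (x + complex_of_real t *\<^sub>C a) - t * q a"
  shows "sublinear (r a)" and "0 \<le> t \<Longrightarrow> r a x \<le> q (x + complex_of_real t *\<^sub>C a) - t * q a"
proof -
  have add: "q (x + y) \<le> q x + q y" for x y using q by (simp add: sublinear_def)
  \<comment> \<open>This bound is independent of \<open>t\<close>, so the infimum defining the tilt
    is finite.\<close>
  have low: "- q (- x) \<le> q (x + complex_of_real t *\<^sub>C a) - t * q a" if "0 \<le> t" for x t
  proof -
    have "t * q a = q (complex_of_real t *\<^sub>C a)" using sublinear_scale[OF q that] by simp
    also have "\<dots> = q ((x + complex_of_real t *\<^sub>C a) + (- x))" by simp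
    also have "\<dots> \<le> q (x + complex_of_real t *\<^sub>C a) + q (- x)" by (rule add)
    finally show ?thesis by simp
  qed
  have bdd: "bdd_below ((\<lambda>t. q (x + complex_of_real t *\<^sub>C a) - t * q a) ` {0..})" for x
    by (rule bdd_belowI2[where m = "- q (- x)"]) (use low in auto)
  show le: "r a x \<le> q (x + complex_of_real t *\<^sub>C a) - t * q a" if "0 \<le> t" for t x
    unfolding r_def by (rule cINF_lower[OF bdd]) (use that in auto)
  have ge: "c \<le> r a x" if "\<And>t. 0 \<le> t \<Longrightarrow> c \<le> q (x + complex_of_real t *\<^sub>C a) - t * q a" for c x
    unfolding r_def by (rule cINF_greatest) (use that in auto)
  have sub: "r a (x + y) \<le> r a x + r a y" for x y
  proof -
    have "r a (x + y) - r a y \<le> r a x"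
    proof (rule ge)
      fix s :: real assume s: "0 \<le> s"
      have "r a (x + y) - (q (x + complex_of_real s *\<^sub>C a) - s * q a) \<le> r a y"
      proof (rule ge)
        fix t :: real assume t: "0 \<le> t"
        \<comment> \<open>Parameters chosen separately for \<open>x\<close> and \<open>y\<close> add
          up to an admissible one for \<open>x + y\<close>.\<close>
        have "r a (x + y) \<le> q ((x + y) + complex_of_real (s + t) *\<^sub>C a) - (s + t) * q a"
          using s t by (intro le) auto
        also have "(x + y) + complex_of_real (s + t) *\<^sub>C a
            = (x + complex_of_real s *\<^sub>C a) + (y + complex_of_real t *\<^sub>C a)"
          by (simp add: scaleC_add_left algebra_simps)
        finally show "r a (x + y) - (q (x + complex_of_real s *\<^sub>C a) - s * q a)
            \<le> q (y + complex_of_real t *\<^sub>C a) - t * q a"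
          using add[of "x + complex_of_real s *\<^sub>C a" "y + complex_of_real t *\<^sub>C a"]
          by (simp add: algebra_simps)
      qed
      then show "r a (x + y) - r a y \<le> q (x + complex_of_real s *\<^sub>C a) - s * q a" by simp
    qed
    then show ?thesis by simp
  qed
  have hom: "r a (complex_of_real s *\<^sub>C x) \<le> s * r a x" if s: "0 < s" for s x
  proof -
    have "r a (complex_of_real s *\<^sub>C x) / s \<le> r a x"
    proof (rule ge)
      fix t :: real assume t: "0 \<le> t"
      have "r a (complex_of_real s *\<^sub>C x)
          \<le> q (complex_of_real s *\<^sub>C x + complex_of_real (s * t) *\<^sub>C a) - (s * t) * q a"
        using s t by (intro le) auto
      also have "complex_of_real s *\<^sub>C x + complex_of_real (s * t) *\<^sub>C a
          = complex_of_real s *\<^sub>C (x + complex_of_real t *\<^sub>C a)"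
        by (simp add: scaleC_add_right scaleC_scaleC)
      also have "q \<dots> = s * q (x + complex_of_real t *\<^sub>C a)" using s q by (simp add: sublinear_def)
      finally show "r a (complex_of_real s *\<^sub>C x) / s \<le> q (x + complex_of_real t *\<^sub>C a) - t * q a"
        using s by (simp add: field_simps)
    qed
    then show ?thesis using s by (simp add: field_simps)
  qed
  show "sublinear (r a)"
    unfolding sublinear_def
  proof (intro conjI allI impI sub antisym hom)
    \<comment> \<open>The converse inequality is \<open>hom\<close> with factor \<open>1 / s\<close>
      at the scaled point.\<close>
    fix s :: real and x assume s: "0 < s"
    have "r a (complex_of_real (1 / s) *\<^sub>C complex_of_real s *\<^sub>C x) \<le> 1 / s * r a (complex_of_real s *\<^sub>C x)"
      by (rule hom) (use s in auto)
    then show "s * r a x \<le> r a (complex_of_real s *\<^sub>C x)"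
      using s by (simp add: field_simps scaleC_scaleC scaleC_one)
  qed
qed

text \<open>Zorn's lemma for the reversed pointwise order. The pointwise infimum bounds a chain from
  below; it is finite because every member \<open>q \<le> p\<close> satisfies
  \<open>- p (- x) \<le> q x\<close>.\<close>

lemma sublinear_minimal:
  fixes p :: "'b::complex_vector \<Rightarrow> real"
  assumes p: "sublinear p"
  shows "\<exists>q. sublinear q \<and> q \<le> p \<and> (\<forall>r. sublinear r \<longrightarrow> r \<le> q \<longrightarrow> r = q)"
proof -
  let ?A = "{q. sublinear q \<and> q \<le> p}"
  have "\<exists>m\<in>?A. \<forall>a\<in>?A. m \<ge> a \<longrightarrow> a = m"
  proof (rule predicate_Zorn[where P = "\<lambda>x y. x \<ge> y"])
    show "partial_order_on ?A (relation_of (\<lambda>x y. x \<ge> y) ?A)"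
      by (rule partial_order_on_relation_ofI) auto
  next
    fix C assume C: "C \<in> Chains (relation_of (\<lambda>x y. x \<ge> y) ?A)"
    then have CA: "C \<subseteq> ?A" by (auto simp: Chains_def relation_of_def)
    have total: "a \<le> b \<or> b \<le> a" if "a \<in> C" "b \<in> C" for a b
      using C that by (auto simp: Chains_def relation_of_def)
    show "\<exists>u\<in>?A. \<forall>a\<in>C. u \<le> a"
    proof (cases "C = {}")
      case True
      then show ?thesis using p by auto
    next
      case False
      define u where "u x = (INF q\<in>C. q x)" for x
      have low: "- p (- x) \<le> q x" if "q \<in> C" for q x
      proof -
        have "sublinear q" "q (- x) \<le> p (- x)" using that CA by (auto simp: le_fun_def)
        then show ?thesis using sublinear_ge_minus[of q x] by simp
      qed
      have bdd: "bdd_below ((\<lambda>q. q x) ` C)" for x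
        by (rule bdd_belowI2[OF low])
      have le: "u x \<le> q x" if "q \<in> C" for q x
        unfolding u_def by (rule cINF_lower[OF bdd that])
      have ge: "c \<le> u x" if "\<And>q. q \<in> C \<Longrightarrow> c \<le> q x" for c x
        unfolding u_def by (rule cINF_greatest[OF False that])
      have sub: "u (x + y) \<le> u x + u y" for x y
      proof -
        have "u (x + y) - u y \<le> u x"
        proof (rule ge)
          fix q assume q: "q \<in> C"
          have "u (x + y) - q x \<le> u y"
          proof (rule ge)
            fix q' assume q': "q' \<in> C"
            have *: "u (x + y) \<le> q'' x + q'' y" if "q'' \<in> C" for q''
            proof -
              have "sublinear q''" using that CA by auto
              then show ?thesis using le[OF that, of "x + y"] unfolding sublinear_def by (meson order_trans)
            qed
            \<comment> \<open>Subadditivity needs one and the same member at both points. The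
              smaller of \<open>q\<close> and \<open>q'\<close> serves, which is where the chain
              property enters.\<close>
            show "u (x + y) - q x \<le> q' y"
              using total[OF q q']
            proof
              assume "q \<le> q'"
              then show ?thesis using *[OF q] le_funD[of q q' y] by simp
            next
              assume "q' \<le> q"
              then show ?thesis using *[OF q'] le_funD[of q' q x] by simp
            qed
          qed
          then show "u (x + y) - u y \<le> q x" by simp
        qed
        then show ?thesis by simp
      qed
      have hom: "u (complex_of_real t *\<^sub>C x) = t * u x" if t: "0 < t" for t x
      proof (rule antisym)
        have q: "q (complex_of_real t *\<^sub>C x) = t * q x" if "q \<in> C" for q
          using CA that t by (auto simp: sublinear_def)
        have "u (complex_of_real t *\<^sub>C x) / t \<le> u x"
          by (rule ge) (use le[of _ "complex_of_real t *\<^sub>C x"] q t in \<open>fastforce simp: field_simps\<close>)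
        then show "u (complex_of_real t *\<^sub>C x) \<le> t * u x" using t by (simp add: field_simps)
        show "t * u x \<le> u (complex_of_real t *\<^sub>C x)"
        proof (rule ge)
          fix r assume "r \<in> C"
          then show "t * u x \<le> r (complex_of_real t *\<^sub>C x)"
            using q[of r] mult_left_mono[OF le[of r x], of t] t by simp
        qed
      qed
      have "u \<le> p"
      proof (rule le_funI)
        fix x
        obtain q where "q \<in> C" using False by blast
        then have "u x \<le> q x" "q x \<le> p x" using le CA by (auto simp: le_fun_def)
        then show "u x \<le> p x" by simp
      qed
      then show ?thesis
        using sub hom le by (intro bexI[of _ u] ballI) (simp_all add: sublinear_def le_fun_def)
    qed
  qed
  then obtain m where m: "m \<in> ?A" "\<forall>a\<in>?A. a \<le> m \<longrightarrow> a = m" by (rule bexE)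
  have "r = m" if "sublinear r" "r \<le> m" for r
  proof -
    have "r \<in> ?A" using that m(1) order_trans[of r m p] by simp
    then show ?thesis using m(2) that(2) by simp
  qed
  then show ?thesis using m(1) by (intro exI[of _ m]) simp
qed

theorem hahn_banach_sublinear:
  fixes p :: "'b::complex_vector \<Rightarrow> real"
  assumes "sublinear p"
  obtains f where "\<And>x y. f (x + y) = f x + f y" "\<And>t x. f (complex_of_real t *\<^sub>C x) = t * f x"
    "\<And>x. f x \<le> p x"
proof -
  obtain q where q: "sublinear q" "q \<le> p" and min: "\<forall>r. sublinear r \<longrightarrow> r \<le> q \<longrightarrow> r = q"
    using sublinear_minimal[OF assms] by (elim exE conjE)
  have "q x + q a \<le> q (x + a)" for x a
  proof -
    let ?r = "\<lambda>x. INF t\<in>{0..}. q (x + complex_of_real t *\<^sub>C a) - t * q a"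
    have "?r \<le> q" using sublinear_tilt(2)[OF q(1), of 0 _ a] by (simp add: le_fun_def)
    then have "?r = q" using min sublinear_tilt(1)[OF q(1)] by simp
    then show ?thesis using sublinear_tilt(2)[OF q(1), of 1 x a] by (simp add: scaleC_one fun_eq_iff)
  qed
  then have add: "q (x + y) = q x + q y" for x y
    using q(1) by (meson antisym sublinear_def)
  have minus: "q (- x) = - q x" for x
    using add[of x "- x"] sublinear_zero[OF q(1)] by simp
  have "q (complex_of_real t *\<^sub>C x) = t * q x" for t x
  proof (cases "0 \<le> t")
    case False
    then show ?thesis
      using sublinear_scale[OF q(1), of "- t" x] by (simp add: scaleC_minus_left minus)
  qed (rule sublinear_scale[OF q(1)])
  then show thesis by (intro that[of q] add le_funD[OF q(2)])
qed

text \<open>Krein's extension theorem.  The Hahn--Banach theorem is applied to the functional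
  \<open>x \<mapsto> inf {Re s(y) | y \<in> M, (y - x) + (y - x)\<^sup>* \<in> P}\<close>, which vanishes on the
  antihermitian elements.\<close>

theorem positive_extension:
  fixes star :: "'b::complex_vector \<Rightarrow> 'b" and s :: "'b \<Rightarrow> complex"
  assumes star: "\<And>x y. star (x + y) = star x + star y" "\<And>c x. star (c *\<^sub>C x) = cnj c *\<^sub>C star x"
      "\<And>x. star (star x) = x"
    and M: "\<And>x y. x \<in> M \<Longrightarrow> y \<in> M \<Longrightarrow> x + y \<in> M" "\<And>c x. x \<in> M \<Longrightarrow> c *\<^sub>C x \<in> M"
      "\<And>x. x \<in> M \<Longrightarrow> star x \<in> M" "0 \<in> M"
    and P: "\<And>x y. x \<in> P \<Longrightarrow> y \<in> P \<Longrightarrow> x + y \<in> P"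
      "\<And>t x. 0 \<le> t \<Longrightarrow> x \<in> P \<Longrightarrow> complex_of_real t *\<^sub>C x \<in> P"
      "0 \<in> P" "\<And>x. x \<in> P \<Longrightarrow> star x = x"
    and cofinal: "\<And>x. \<exists>m. m \<in> M \<and> m \<in> P \<and> m + (x + star x) \<in> P"
    and s: "\<And>x y. x \<in> M \<Longrightarrow> y \<in> M \<Longrightarrow> s (x + y) = s x + s y"
      "\<And>c x. x \<in> M \<Longrightarrow> s (c *\<^sub>C x) = c * s x"
      "\<And>x. x \<in> M \<Longrightarrow> x \<in> P \<Longrightarrow> s x \<in> \<real>\<^sub>\<ge>\<^sub>0"
  shows "\<exists>f. (\<forall>x y. f (x + y) = f x + f y) \<and> (\<forall>c x. f (c *\<^sub>C x) = c * f x) \<and>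
    (\<forall>x\<in>M. f x = s x) \<and> (\<forall>x\<in>P. f x \<in> \<real>\<^sub>\<ge>\<^sub>0)"
proof -
  have minus: "- x = (-1) *\<^sub>C (x::'b)" for x by (simp add: scaleC_minus_left scaleC_one)
  have half: "complex_of_real (1/2) *\<^sub>C (x + x) = (x::'b)" for x
    using scaleC_add_left[of "1/2" "1/2" x] by (simp add: scaleC_add_right scaleC_one)
  have star0: "star 0 = 0" using star(2)[of 0 0] by simp
  have starm: "star (- x) = - star x" for x
    using star(2)[of "-1" x] by (simp add: scaleC_minus_left scaleC_one)
  have Mm: "- x \<in> M" if "x \<in> M" for x using M(2)[OF that, of "-1"] by (simp add: minus)
  have sm: "s (- x) = - s x" if "x \<in> M" for x using s(2)[OF that, of "-1"] by (simp add: minus)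
  have Md: "x - y \<in> M" and sd: "s (x - y) = s x - s y" if "x \<in> M" "y \<in> M" for x y
    using M(1)[OF that(1) Mm[OF that(2)]] s(1)[OF that(1) Mm[OF that(2)]] sm[OF that(2)] by simp_all
  have s0: "s 0 = 0" using s(2)[OF M(4), of 0] by simp
  \<comment> \<open>Both \<open>m\<close> and \<open>m + (x + x)\<close> are positive elements of
    \<open>M\<close>, so \<open>s\<close> is real on each and hence on their difference.\<close>
  have real_s: "Im (s x) = 0" if "x \<in> M" "star x = x" for x
  proof -
    obtain m where m: "m \<in> M" "m \<in> P" "m + (x + star x) \<in> P" using cofinal by blast
    have xx: "x + x \<in> M" by (intro M that)
    then have "s (m + (x + x)) = s m + (s x + s x)" using s(1) m that by simp
    moreover have "s (m + (x + x)) \<in> \<real>\<^sub>\<ge>\<^sub>0" using m that M(1)[OF m(1) xx] s(3) by simp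
    ultimately show ?thesis using s(3)[OF m(1,2)] by (simp add: complex_nonneg_Reals_iff)
  qed
  \<comment> \<open>The multiple by \<i> of \<open>y - star y\<close> is selfadjoint; reality of
    \<open>s\<close> there compares the real parts at \<open>y\<close> and
    \<open>star y\<close>.\<close>
  have Re_star: "Re (s (star y)) = Re (s y)" if y: "y \<in> M" for y
  proof -
    have "star (\<i> *\<^sub>C (y + - star y)) = \<i> *\<^sub>C (y + - star y)"
      by (simp add: star starm scaleC_minus_left scaleC_add_right scaleC_minus_right del: add_uminus_conv_diff)
    then have "Im (s (\<i> *\<^sub>C (y + - star y))) = 0" by (intro real_s M Mm y)
    then show ?thesis using y by (simp add: s M Md sd)
  qed
  define h where "h x = x + star x" for x
  have h_add: "h (x + y) = h x + h y" for x y by (simp add: h_def star)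
  have h_minus: "h (- x) = - h x" for x by (simp add: h_def starm)
  have h_diff: "h (x - y) = h x - h y" for x y using h_add[of x "- y"] h_minus[of y] by simp
  have h_scale: "h (complex_of_real t *\<^sub>C x) = complex_of_real t *\<^sub>C h x" for t x
    by (simp add: h_def star scaleC_add_right)
  have hM: "h y \<in> M" if "y \<in> M" for y using that by (simp add: h_def M)
  have Re_h: "Re (s (h y)) = 2 * Re (s y)" if "y \<in> M" for y
    using that Re_star by (simp add: h_def s M)
  define D where "D x = {y \<in> M. h (y + - x) \<in> P}" for x
  define p where "p x = (INF y\<in>D x. Re (s y))" for x
  have D_ne: "D x \<noteq> {}" for x
  proof -
    obtain m where m: "m \<in> M" "m \<in> P" "m + (- x + star (- x)) \<in> P" using cofinal by blast
    \<comment> \<open>The factor \<open>1/2\<close> compensates for \<open>h\<close>, which doubles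
      a selfadjoint element.\<close>
    have "h (complex_of_real (1/2) *\<^sub>C m + - x) = m + h (- x)"
      using P(4)[OF m(2)] half[of m] by (simp only: h_add h_scale) (simp add: h_def)
    moreover have "m + h (- x) \<in> P" using m(3) by (simp add: h_def)
    ultimately have "h (complex_of_real (1/2) *\<^sub>C m + - x) \<in> P" by (simp only:)
    then have "complex_of_real (1/2) *\<^sub>C m \<in> D x" using M(2)[OF m(1)] unfolding D_def by blast
    then show ?thesis by blast
  qed
  have bdd: "bdd_below ((\<lambda>y. Re (s y)) ` D x)" for x
  proof -
    obtain m where m: "m \<in> M" "m \<in> P" "m + (x + star x) \<in> P" using cofinal by blast
    \<comment> \<open>In the order of the cone \<open>h y\<close> dominates \<open>h x\<close>,
      which dominates \<open>- m\<close>; so \<open>h y + m\<close> is positive and \<open>s\<close>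
      can be applied to it.\<close>
    have "- Re (s m) / 2 \<le> Re (s y)" if "y \<in> D x" for y
    proof -
      have y: "y \<in> M" "h (y + - x) \<in> P" using that by (auto simp: D_def)
      have "h (y + - x) + (m + h x) \<in> P" using P(1)[OF y(2) m(3)] by (simp only: h_def)
      then have "h y + m \<in> P" by (simp add: h_diff algebra_simps)
      then have "s (h y + m) \<in> \<real>\<^sub>\<ge>\<^sub>0" using y m by (intro s M hM)
      then show ?thesis using y m by (simp add: s hM Re_h complex_nonneg_Reals_iff)
    qed
    then show ?thesis by (rule bdd_belowI2)
  qed
  have le: "p x \<le> Re (s y)" if "y \<in> D x" for x y
    unfolding p_def by (rule cINF_lower[OF bdd that])
  have ge: "c \<le> p x" if "\<And>y. y \<in> D x \<Longrightarrow> c \<le> Re (s y)" for c x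
    unfolding p_def by (rule cINF_greatest[OF D_ne that])
  have D_add: "y + y' \<in> D (x + x')" if "y \<in> D x" "y' \<in> D x'" for x x' y y'
  proof -
    have "h (y + - x) + h (y' + - x') \<in> P" using that P(1) unfolding D_def by blast
    also have "h (y + - x) + h (y' + - x') = h (y + y' + - (x + x'))" by (simp add: h_add h_diff h_minus)
    finally show ?thesis using that by (auto simp: D_def M)
  qed
  have D_scale: "complex_of_real t *\<^sub>C y \<in> D (complex_of_real t *\<^sub>C x)" if "y \<in> D x" "0 \<le> t" for x y t
  proof -
    have "complex_of_real t *\<^sub>C h (y + - x) \<in> P" using that P(2) by (auto simp: D_def)
    then show ?thesis using that
      by (simp add: D_def M h_scale h_diff scaleC_diff_right)
  qed
  have "sublinear p"
    unfolding sublinear_def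
  proof (intro conjI allI impI)
    fix x x'
    have "p (x + x') - p x' \<le> p x"
    proof (rule ge)
      fix y assume y: "y \<in> D x"
      have "p (x + x') - Re (s y) \<le> p x'"
      proof (rule ge)
        fix y' assume y': "y' \<in> D x'"
        have "s (y + y') = s y + s y'" using y y' by (intro s) (auto simp: D_def)
        then show "p (x + x') - Re (s y) \<le> Re (s y')" using le[OF D_add[OF y y']] by simp
      qed
      then show "p (x + x') - p x' \<le> Re (s y)" by simp
    qed
    then show "p (x + x') \<le> p x + p x'" by simp
  next
    have *: "p (complex_of_real t *\<^sub>C x) \<le> t * p x" if t: "0 < t" for t :: real and x
    proof -
      have "p (complex_of_real t *\<^sub>C x) / t \<le> p x"
      proof (rule ge)
        fix y assume y: "y \<in> D x"
        then have "s (complex_of_real t *\<^sub>C y) = t * s y" by (intro s) (auto simp: D_def)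
        then show "p (complex_of_real t *\<^sub>C x) / t \<le> Re (s y)"
          using le[OF D_scale[OF y, of t]] t by (simp add: field_simps)
      qed
      then show ?thesis using t by (simp add: field_simps)
    qed
    fix t :: real and x assume t: "0 < t"
    show "p (complex_of_real t *\<^sub>C x) = t * p x"
    proof (rule antisym[OF *[OF t]])
      show "t * p x \<le> p (complex_of_real t *\<^sub>C x)"
        using *[of "1 / t" "complex_of_real t *\<^sub>C x"] t
        by (simp add: field_simps scaleC_scaleC scaleC_one)
    qed
  qed
  then obtain f where f: "\<And>x y. f (x + y) = f x + f y" "\<And>t x. f (complex_of_real t *\<^sub>C x) = t * f x"
    "\<And>x. f x \<le> p x"
    by (rule hahn_banach_sublinear) blast
  have fm: "f (- x) = - f x" for x using f(2)[of "-1" x] by (simp add: minus)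
  \<comment> \<open>For positive \<open>h x\<close> the element \<open>0\<close> competes in the
    infimum defining \<open>p (- x)\<close>.\<close>
  have f_nonpos: "f (- x) \<le> 0" if "h x \<in> P" for x
  proof -
    have "0 \<in> D (- x)" using that by (simp add: D_def M)
    then show ?thesis using le[of 0 "- x"] f(3)[of "- x"] s0 by simp
  qed
  have f_pos: "0 \<le> f x" if "h x \<in> P" for x using f_nonpos[OF that] fm by simp
  have f_M: "f y = Re (s y)" if y: "y \<in> M" for y
  proof -
    have *: "f z \<le> Re (s z)" if "z \<in> M" for z
    proof -
      have "z \<in> D z" using that P(3) by (simp add: D_def h_def star0)
      then show ?thesis using le f(3) order_trans by blast
    qed
    show ?thesis using *[OF y] *[OF Mm[OF y]] y by (simp add: fm sm)
  qed
  have f_anti: "f x = 0" if "star x = - x" for x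
  proof -
    have "h x = 0" "h (- x) = 0" using that by (simp_all add: h_def starm)
    then show ?thesis using f_pos[of x] f_pos[of "- x"] P(3) fm by simp
  qed
  define g where "g x = Complex (f x) (- f (\<i> *\<^sub>C x))" for x
  have split: "c *\<^sub>C x = complex_of_real (Re c) *\<^sub>C x + complex_of_real (Im c) *\<^sub>C \<i> *\<^sub>C x" for c and x :: 'b
  proof -
    have "complex_of_real (Re c) + complex_of_real (Im c) * \<i> = c"
      by (simp add: complex_eq_iff)
    then show ?thesis
      using scaleC_add_left[of "complex_of_real (Re c)" "complex_of_real (Im c) * \<i>" x]
      by (simp add: scaleC_scaleC)
  qed
  have "g (c *\<^sub>C x) = c * g x" for c x
  proof -
    have 1: "f (c *\<^sub>C x) = Re c * f x + Im c * f (\<i> *\<^sub>C x)"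
      by (subst split) (simp add: f)
    have "\<i> *\<^sub>C c *\<^sub>C x = c *\<^sub>C \<i> *\<^sub>C x" by (rule scaleC_commute)
    also have "f \<dots> = Re c * f (\<i> *\<^sub>C x) + Im c * f (\<i> *\<^sub>C \<i> *\<^sub>C x)"
      by (subst split) (simp add: f)
    also have "\<i> *\<^sub>C \<i> *\<^sub>C x = - x" by (simp add: scaleC_scaleC minus)
    finally show ?thesis using 1 by (simp add: g_def complex_eq_iff fm algebra_simps)
  qed
  moreover have "g x \<in> \<real>\<^sub>\<ge>\<^sub>0" if "x \<in> P" for x
  proof -
    have "h x = complex_of_real 2 *\<^sub>C x" using P(4)[OF that] scaleC_add_left[of 1 1 x] by (simp add: h_def scaleC_one)
    then have "h x \<in> P" using P(2)[of 2 x] that by simp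
    \<comment> \<open>A selfadjoint \<open>x\<close> has an antihermitian multiple by \<i>, so
      \<open>g\<close> is real on the cone.\<close>
    moreover have "f (\<i> *\<^sub>C x) = 0"
      by (rule f_anti) (simp add: star P(4)[OF that] scaleC_minus_left)
    ultimately show ?thesis using f_pos by (simp add: g_def complex_nonneg_Reals_iff)
  qed
  moreover have "g (x + y) = g x + g y" for x y
    by (simp add: g_def f scaleC_add_right complex_eq_iff)
  moreover have "g x = s x" if "x \<in> M" for x
    using that by (simp add: g_def f_M M s complex_eq_iff)
  ultimately show ?thesis by (intro exI[of _ g]) blast
qed

section \<open>Square roots in a C*-algebra\<close>

lemma adj_zero [simp]: "adj (0::'a::unital_cstar_algebra) = 0"
  using adj_add[of "0::'a" 0] by simp

lemma adj_one [simp]: "adj (1::'a::unital_cstar_algebra) = 1"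
  using adj_mult[of "adj 1" "1::'a"] by (simp add: adj_adj)

lemma adj_minus: "adj (- x) = - adj (x::'a::unital_cstar_algebra)"
  using adj_add[of x "- x"] by (simp add: add_eq_0_iff)

lemma adj_diff: "adj (x - y) = adj x - adj (y::'a::unital_cstar_algebra)"
  using adj_add[of x "- y"] by (simp add: adj_minus)

lemma adj_sum: "adj (\<Sum>i\<in>I. f i) = (\<Sum>i\<in>I. adj (f i :: 'a::unital_cstar_algebra))"
  by (induction I rule: infinite_finite_induct) (simp_all add: adj_add)

lemma norm_adj: "norm (adj x) = norm (x::'a::unital_cstar_algebra)"
proof -
  have "norm y \<le> norm (adj y)" for y :: 'a
  proof (cases "y = 0")
    case False
    have "norm y * norm y \<le> norm (adj y) * norm y"
      using cstar_identity[of y] norm_mult_ineq[of "adj y" y] by (simp add: power2_eq_square)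
    then show ?thesis using False by simp
  qed simp
  from this[of x] this[of "adj x"] show ?thesis by (simp add: adj_adj)
qed

text \<open>The root is \<open>1 - y\<close> for the fixed point \<open>y\<close> of the contraction \<open>y \<mapsto> (c + y\<^sup>2) / 2\<close>;
  by uniqueness \<open>y\<close> is selfadjoint when \<open>c\<close> is.\<close>

lemma sqrt_one_minus:
  fixes c :: "'a::unital_cstar_algebra"
  assumes c: "adj c = c" "norm c \<le> 3/4"
  shows "\<exists>b. 1 - c = adj b * b"
proof -
  define g where "g y = (1/2) *\<^sub>R (c + y * y)" for y :: 'a
  \<comment> \<open>Radius \<open>1/2\<close> fits the bound \<open>3/4\<close>:
    \<open>(3/4 + 1/4) / 2 = 1/2\<close> keeps the ball invariant, and on it the map has Lipschitz
    constant \<open>1/2\<close>.\<close>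
  let ?B = "cball (0::'a) (1/2)"
  have "\<exists>!y\<in>?B. g y = y"
  proof (rule Banach_fix[where c = "1/2"])
    show "complete ?B" by (simp add: complete_eq_closed)
    show "?B \<noteq> {}" by simp
    show "g ` ?B \<subseteq> ?B"
    proof clarify
      fix y :: 'a assume "y \<in> ?B"
      then have y: "norm y \<le> 1/2" by simp
      have "norm (c + y * y) \<le> norm c + norm y * norm y"
        by (rule norm_triangle_le) (use norm_mult_ineq[of y y] in simp)
      also have "norm y * norm y \<le> 1/2 * (1/2)" by (rule mult_mono) (use y in auto)
      finally show "g y \<in> ?B" using c(2) by (simp add: g_def)
    qed
    fix x y :: 'a assume "x \<in> ?B" "y \<in> ?B"
    then have xy: "norm x \<le> 1/2" "norm y \<le> 1/2" by auto
    have "g x - g y = (1/2) *\<^sub>R (x * (x - y) + (x - y) * y)"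
      by (simp add: g_def algebra_simps)
    moreover have "norm (x * (x - y) + (x - y) * y) \<le> norm x * norm (x - y) + norm (x - y) * norm y"
      by (rule norm_triangle_le) (use norm_mult_ineq[of x "x - y"] norm_mult_ineq[of "x - y" y] in simp)
    moreover have "\<dots> \<le> 1/2 * norm (x - y) + norm (x - y) * (1/2)"
      by (intro add_mono mult_mono xy) auto
    ultimately show "dist (g x) (g y) \<le> 1/2 * dist x y"
      unfolding dist_norm by simp
  qed auto
  then obtain y where y: "y \<in> ?B" "g y = y" and uniq: "\<And>z. z \<in> ?B \<Longrightarrow> g z = z \<Longrightarrow> z = y" by blast
  have adjR: "adj (r *\<^sub>R x) = r *\<^sub>R adj x" for r and x :: 'a
    by (simp add: scaleR_scaleC adj_scaleC)
  have "g (adj y) = adj (g y)" by (simp add: g_def adjR adj_add adj_mult c)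
  then have sa: "adj y = y" using uniq[of "adj y"] y by (simp add: norm_adj)
  have "c + y * y = 2 *\<^sub>R y" using y(2) by (simp add: g_def) (metis scaleR_half_double scaleR_2 real_vector.scale_scale scaleR_right_distrib)
  then have "1 - c = (1 - y) * (1 - y)" by (simp add: algebra_simps scaleR_2)
  then show ?thesis by (intro exI[of _ "1 - y"]) (simp add: adj_diff sa)
qed

text \<open>Replaces the order estimate of \<open>adj a * a\<close> by a multiple of the unit,
  without spectral theory. The factor \<open>4/3\<close> brings the rescaled square below the bound
  \<open>3/4\<close> of \<open>sqrt_one_minus\<close>; the summand \<open>1\<close> keeps
  \<open>t\<close> positive for \<open>a = 0\<close>.\<close>

lemma norm_square_minus:
  fixes a :: "'a::unital_cstar_algebra"
  shows "\<exists>t\<ge>0. \<exists>b. complex_of_real t *\<^sub>C 1 - adj a * a = adj b * b"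
proof -
  define t where "t = 4/3 * (norm a)\<^sup>2 + 1"
  have t: "0 < t" by (simp add: t_def add_nonneg_pos)
  define c where "c = complex_of_real (1/t) *\<^sub>C (adj a * a)"
  have "adj c = c" by (simp add: c_def adj_scaleC adj_mult adj_adj)
  moreover have "norm c \<le> 3/4"
    using t by (simp add: c_def norm_scaleC norm_divide cstar_identity field_simps) (simp add: t_def)
  ultimately obtain b where b: "1 - c = adj b * b" using sqrt_one_minus by blast
  define b' where "b' = complex_of_real (sqrt t) *\<^sub>C b"
  have "adj b' * b' = complex_of_real t *\<^sub>C (adj b * b)"
    using t by (simp add: b'_def adj_scaleC mult_scaleC_left mult_scaleC_right scaleC_scaleC flip: of_real_mult)
  also have "\<dots> = complex_of_real t *\<^sub>C 1 - adj a * a"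
    using t by (simp add: b[symmetric] c_def scaleC_diff_right scaleC_scaleC scaleC_one flip: of_real_mult of_real_divide)
  finally show ?thesis using t by (intro exI[of _ t]) (auto intro!: exI[of _ b'])
qed

section \<open>The Riesz representation theorem\<close>

lemma cinner_add_right: "cinner x (y + z) = cinner x y + cinner x (z::'y::complex_inner)"
  by (metis cinner_commute cinner_add_left complex_cnj_add)

lemma cinner_scaleC_right: "cinner x (a *\<^sub>C y) = cnj a * cinner x (y::'y::complex_inner)"
  by (metis cinner_commute cinner_scaleC_left complex_cnj_mult)

lemma cinner_zero_left [simp]: "cinner 0 (y::'y::complex_inner) = 0"
  using cinner_add_left[of 0 0 y] by simp

lemma cinner_zero_right [simp]: "cinner (y::'y::complex_inner) 0 = 0"
  using cinner_add_right[of y 0 0] by simp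

lemma cinner_minus_left: "cinner (- x) (y::'y::complex_inner) = - cinner x y"
  using cinner_add_left[of x "- x" y] by (simp add: add_eq_0_iff)

lemma cinner_minus_right: "cinner x (- y::'y::complex_inner) = - cinner x y"
  using cinner_add_right[of x y "- y"] by (simp add: add_eq_0_iff)

lemma cinner_diff_left: "cinner (x - y) (z::'y::complex_inner) = cinner x z - cinner y z"
  using cinner_add_left[of x "- y" z] by (simp add: cinner_minus_left)

lemma cinner_sum_left: "cinner (\<Sum>i\<in>I. f i) (y::'y::complex_inner) = (\<Sum>i\<in>I. cinner (f i) y)"
  by (induction I rule: infinite_finite_induct) (simp_all add: cinner_add_left)

lemma cinner_eqI: "(\<And>z. cinner x z = cinner y z) \<Longrightarrow> x = (y::'y::complex_inner)"
  using cinner_self[of "x - y"] by (auto simp: cinner_diff_left)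

lemma norm_add_square: "(norm (x + y))\<^sup>2 = (norm x)\<^sup>2 + (norm y)\<^sup>2 + 2 * Re (cinner x (y::'y::complex_inner))"
proof -
  have "Re (cinner y x) = Re (cinner x y)" using cinner_commute[of x y] by simp
  moreover have "complex_of_real ((norm (x + y))\<^sup>2)
      = complex_of_real ((norm x)\<^sup>2) + cinner x y + (cinner y x + complex_of_real ((norm y)\<^sup>2))"
    by (simp only: cinner_self[symmetric] cinner_add_left cinner_add_right) (simp add: algebra_simps)
  then have "Re (complex_of_real ((norm (x + y))\<^sup>2))
      = Re (complex_of_real ((norm x)\<^sup>2) + cinner x y + (cinner y x + complex_of_real ((norm y)\<^sup>2)))"
    by (rule arg_cong)
  ultimately show ?thesis by simp
qed

lemma cinner_bound: "cmod (cinner x y) \<le> norm x * norm (y::'y::complex_inner)"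
proof (cases "norm y = 0")
  case False
  define c where "c = cinner x y / complex_of_real ((norm y)\<^sup>2)"
  have "Re (cinner x (- (c *\<^sub>C y))) = - (cmod (cinner x y))\<^sup>2 / (norm y)\<^sup>2"
  proof -
    have "cinner x (- (c *\<^sub>C y)) = - (cnj c * cinner x y)"
      by (simp add: cinner_minus_right cinner_scaleC_right)
    also have "cnj c * cinner x y = complex_of_real ((cmod (cinner x y))\<^sup>2 / (norm y)\<^sup>2)"
      using complex_norm_square[of "cinner x y"] by (simp add: c_def mult.commute)
    finally show ?thesis by simp
  qed
  moreover have "(norm (- (c *\<^sub>C y)))\<^sup>2 = (cmod (cinner x y))\<^sup>2 / (norm y)\<^sup>2"
    using False by (simp add: norm_scaleC c_def norm_divide norm_mult power2_eq_square)
  ultimately have "0 \<le> (norm x)\<^sup>2 - (cmod (cinner x y))\<^sup>2 / (norm y)\<^sup>2"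
    using norm_add_square[of x "- (c *\<^sub>C y)"] zero_le_power2[of "norm (x + - (c *\<^sub>C y))"] by linarith
  then have "(cmod (cinner x y))\<^sup>2 \<le> (norm x * norm y)\<^sup>2"
    using False by (simp add: field_simps power_mult_distrib)
  then show ?thesis by (rule power2_le_imp_le) simp
qed auto

lemma zero_of_quadratic_nonneg:
  fixes a b :: real
  assumes "\<And>t. 0 \<le> t\<^sup>2 * a + 2 * t * b"
  shows "b = 0"
proof (rule ccontr)
  assume b: "b \<noteq> 0"
  \<comment> \<open>As \<open>a < c\<close> and \<open>b\<close> is nonzero, the quadratic is
    negative at \<open>t = - b / c\<close>.\<close>
  define c where "c = \<bar>a\<bar> + 1"
  have "0 \<le> (- b / c)\<^sup>2 * a + 2 * (- b / c) * b" by (rule assms)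
  also have "\<dots> = b\<^sup>2 / c * (a / c - 2)" by (simp add: power2_eq_square algebra_simps)
  also have "\<dots> < 0"
    using b by (intro mult_pos_neg) (auto simp: c_def field_simps add_pos_nonneg)
  finally show False by simp
qed

text \<open>The representing vector minimises \<open>\<parallel>u\<parallel>\<^sup>2 - 2 Re (l u)\<close>.\<close>

theorem riesz_representation:
  fixes l :: "'y::chilbert_space \<Rightarrow> complex"
  assumes add: "\<And>u v. l (u + v) = l u + l v" and scale: "\<And>c u. l (c *\<^sub>C u) = c * l u"
    and bound: "\<And>u. cmod (l u) \<le> C * norm u"
  shows "\<exists>w. \<forall>u. l u = cinner u w"
proof -
  define F where "F u = (norm u)\<^sup>2 - 2 * Re (l u)" for u
  define d where "d = (INF u. F u)"
  have lower: "- C\<^sup>2 \<le> F u" for u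
  proof -
    have "Re (l u) \<le> C * norm u" using bound[of u] complex_Re_le_cmod[of "l u"] by linarith
    moreover have "0 \<le> (norm u - C)\<^sup>2" by simp
    ultimately show ?thesis by (simp add: F_def power2_diff algebra_simps)
  qed
  have dF: "d \<le> F u" for u
    unfolding d_def by (rule cINF_lower) (auto intro!: bdd_belowI2[OF lower])
  have norm2: "norm (c *\<^sub>C x) ^ 2 = (cmod c)\<^sup>2 * (norm x)\<^sup>2" for c and x :: 'y
    by (simp add: norm_scaleC power_mult_distrib)
  \<comment> \<open>Parallelogram law together with \<open>d \<le> F\<close> at the midpoint: points
    with values near the infimum are close to each other.\<close>
  have mid: "(norm (x - y))\<^sup>2 \<le> 2 * (F x + F y) - 4 * d" for x y
  proof -
    have "d \<le> F ((1/2) *\<^sub>C (x + y))" by (rule dF)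
    also have "\<dots> = (norm (x + y))\<^sup>2 / 4 - Re (l x) - Re (l y)"
      by (simp add: F_def norm2 scale add norm_divide power_divide add_divide_distrib)
    finally show ?thesis
      using norm_add_square[of x y] norm_add_square[of x "- y"]
      by (simp add: F_def cinner_minus_right field_simps)
  qed
  have "\<exists>u. F u < d + 1 / Suc n" for n
  proof -
    have "(INF u. F u) < d + 1 / Suc n" by (simp add: d_def)
    then show ?thesis by (subst (asm) cINF_less_iff) (auto intro!: bdd_belowI2[OF lower])
  qed
  then obtain X where X: "\<And>n. F (X n) < d + 1 / Suc n" by metis
  have "Cauchy X"
  proof (rule metric_CauchyI)
    fix e :: real assume e: "0 < e"
    obtain N where N: "4 / e\<^sup>2 < real N" using reals_Archimedean2 by blast
    show "\<exists>M. \<forall>m\<ge>M. \<forall>n\<ge>M. dist (X m) (X n) < e"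
    proof (intro exI allI impI)
      fix m n assume mn: "N \<le> m" "N \<le> n"
      have N0: "0 < real N" using N e by (meson divide_pos_pos less_trans zero_less_numeral zero_less_power)
      have "1 / Suc m \<le> 1 / real N" "1 / Suc n \<le> 1 / real N"
        using mn N0 by (auto intro!: divide_left_mono)
      then have "F (X m) < d + 1 / real N" "F (X n) < d + 1 / real N"
        using X[of m] X[of n] by (meson add_left_mono less_le_trans)+
      then have "2 * (F (X m) + F (X n)) - 4 * d < 4 * (1 / real N)" by (simp add: algebra_simps)
      then have "(norm (X m - X n))\<^sup>2 < 4 * (1 / real N)"
        using mid[of "X m" "X n"] by (rule le_less_trans[rotated])
      also have "\<dots> < e\<^sup>2" using N N0 e by (simp add: field_simps)
      finally show "dist (X m) (X n) < e" using e by (simp add: dist_norm power2_less_imp_less)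
    qed
  qed
  then obtain w where w: "X \<longlonglongrightarrow> w" using Cauchy_convergent_iff convergent_def by blast
  have bl: "bounded_linear l"
    by (rule bounded_linear_intro[where K = C])
      (use bound in \<open>auto simp: add scaleR_scaleC scale scaleR_conv_of_real mult.commute\<close>)
  have "(\<lambda>n. F (X n)) \<longlonglongrightarrow> F w"
    unfolding F_def by (intro tendsto_intros w bounded_linear.tendsto[OF bl])
  moreover have "(\<lambda>n. d + 1 / Suc n) \<longlonglongrightarrow> d"
    using LIMSEQ_Suc[OF lim_const_over_n[of 1]] tendsto_add[OF tendsto_const, of _ 0 _ d] by fastforce
  ultimately have "F w \<le> d"
    by (rule LIMSEQ_le) (use X less_imp_le in blast)
  \<comment> \<open>First-order condition at the minimiser \<open>w\<close> in direction
    \<open>u\<close>: the coefficient linear in \<open>t\<close> must vanish.\<close>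
  have Re_eq: "Re (l u) = Re (cinner u w)" for u
  proof -
    have "0 \<le> t\<^sup>2 * (norm u)\<^sup>2 + 2 * t * (Re (cinner u w) - Re (l u))" for t
    proof -
      have "F w \<le> F (complex_of_real t *\<^sub>C u + w)" using dF \<open>F w \<le> d\<close> by (meson order_trans)
      then show ?thesis
        by (simp only: F_def norm_add_square norm2 add scale cinner_scaleC_left) (simp add: algebra_simps)
    qed
    then show ?thesis using zero_of_quadratic_nonneg[of "(norm u)\<^sup>2"] by fastforce
  qed
  have "l u = cinner u w" for u
    using Re_eq[of u] Re_eq[of "\<i> *\<^sub>C u"] by (simp add: complex_eq_iff scale cinner_scaleC_left)
  then show ?thesis by blast
qed

section \<open>Operators from bounded sesquilinear forms\<close>

lemma bop_apply_add: "bop_apply T (u + v) = bop_apply T u + bop_apply T (v::'y::complex_normed_vector)"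
  using bop_apply[of T] by (simp add: linear_add bounded_linear.linear)

lemma bop_apply_scaleC: "bop_apply T (c *\<^sub>C v) = c *\<^sub>C bop_apply T (v::'y::complex_normed_vector)"
  using bop_apply[of T] by simp

lemma bop_apply_zero [simp]: "bop_apply T (0::'y::complex_normed_vector) = 0"
  using bop_apply_scaleC[of T 0 0] by simp

theorem sesquilinear_form_bop:
  fixes B :: "'y::chilbert_space \<Rightarrow> 'y \<Rightarrow> complex"
  assumes "\<And>u v w. B (u + v) w = B u w + B v w" "\<And>c u w. B (c *\<^sub>C u) w = c * B u w"
    and "\<And>u v w. B w (u + v) = B w u + B w v" "\<And>c u w. B w (c *\<^sub>C u) = cnj c * B w u"
    and bound: "\<And>u w. cmod (B u w) \<le> C * norm u * norm w"
  shows "\<exists>T. \<forall>u w. cinner (bop_apply T u) w = B u w"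
proof -
  have "\<exists>v. \<forall>w. B u w = cinner v w" for u
  proof -
    \<comment> \<open>Conjugation makes the form linear in \<open>w\<close>, as the Riesz theorem
      expects.\<close>
    have "\<exists>v. \<forall>w. cnj (B u w) = cinner w v"
      by (rule riesz_representation[where C = "C * norm u"]) (use assms in auto)
    then show ?thesis by (metis cinner_commute complex_cnj_cnj)
  qed
  then obtain T where T: "\<And>u w. B u w = cinner (T u) w" by metis
  have add: "T (u + v) = T u + T v" for u v
    by (rule cinner_eqI) (simp add: cinner_add_left assms flip: T)
  have scale: "T (c *\<^sub>C u) = c *\<^sub>C T u" for c u
    by (rule cinner_eqI) (simp add: cinner_scaleC_left assms flip: T)
  have "norm (T u) \<le> norm u * \<bar>C\<bar>" for u
  proof (cases "T u = 0")
    case False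
    have "(norm (T u))\<^sup>2 = cmod (B u (T u))" by (simp add: T cinner_self norm_power)
    also have "\<dots> \<le> C * norm u * norm (T u)" by (rule bound)
    also have "\<dots> \<le> \<bar>C\<bar> * norm u * norm (T u)" by (intro mult_right_mono) auto
    finally show ?thesis using False by (simp add: power2_eq_square mult.commute)
  qed simp
  then have "bounded_linear T"
    by (intro bounded_linear_intro[where K = "\<bar>C\<bar>"]) (auto simp: add scale scaleR_scaleC)
  then have "bop_apply (Bop T) = T" by (intro Bop_inverse) (simp add: scale)
  then show ?thesis by (intro exI[of _ "Bop T"]) (simp add: T)
qed

section \<open>Positive kernels with values in a C*-algebra\<close>

instantiation poly_mapping :: (type, complex_vector) complex_vector
begin

lift_definition scaleC_poly_mapping :: "complex \<Rightarrow> ('a \<Rightarrow>\<^sub>0 'b) \<Rightarrow> 'a \<Rightarrow>\<^sub>0 'b" is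
  "\<lambda>c f k. c *\<^sub>C f k"
  by (rule finite_subset[rotated]) auto

instance
  by standard
    (transfer; simp add: fun_eq_iff scaleC_add_right scaleC_add_left scaleC_scaleC scaleC_one)+

end

lemma lookup_scaleC: "Poly_Mapping.lookup (c *\<^sub>C x) k = c *\<^sub>C Poly_Mapping.lookup x k"
  by transfer simp

lift_definition kernel_adj :: "('j \<times> 'j \<Rightarrow>\<^sub>0 'a::unital_cstar_algebra) \<Rightarrow> ('j \<times> 'j \<Rightarrow>\<^sub>0 'a)" is
  "\<lambda>f (i, j). adj (f (j, i))"
proof -
  fix f :: "'j \<times> 'j \<Rightarrow> 'a" assume "finite {k. f k \<noteq> 0}"
  then show "finite {k. (case k of (i, j) \<Rightarrow> adj (f (j, i))) \<noteq> 0}"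
    by (rule finite_subset[rotated, OF finite_imageI[where h = prod.swap]]) (auto simp: image_iff)
qed

lemma lookup_kernel_adj: "Poly_Mapping.lookup (kernel_adj x) (i, j) = adj (Poly_Mapping.lookup x (j, i))"
  by transfer simp

text \<open>Each \<open>g k\<close> is one row of a factor \<open>B\<close>, and the sum over
  \<open>k\<close> is the matrix product of the adjoint of \<open>B\<close> with \<open>B\<close>.
  Any number of rows is allowed, so adding two elements just stacks their rows.\<close>

definition gram_kernels :: "('j \<times> 'j \<Rightarrow>\<^sub>0 'a::unital_cstar_algebra) set" where
  "gram_kernels = {x. \<exists>m::nat. \<exists>g. (\<forall>k<m. finite {j. g k j \<noteq> 0}) \<and>
     (\<forall>i j. Poly_Mapping.lookup x (i, j) = (\<Sum>k<m. adj (g k i) * g k j))}"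

lemma gram_kernelsI:
  fixes m :: nat
  assumes "\<And>k. k < m \<Longrightarrow> finite {j. g k j \<noteq> 0}"
    and "\<And>i j. Poly_Mapping.lookup x (i, j) = (\<Sum>k<m. adj (g k i) * g k j)"
  shows "x \<in> gram_kernels"
  using assms unfolding gram_kernels_def by blast

lemma gram_kernelsE:
  assumes "x \<in> gram_kernels"
  obtains m g where "\<And>k. k < m \<Longrightarrow> finite {j. g k j \<noteq> 0}"
    "\<And>i j. Poly_Mapping.lookup x (i, j) = (\<Sum>k<m::nat. adj (g k i) * g k j)"
  using assms unfolding gram_kernels_def by blast

lemma gram_kernels_add:
  assumes "x \<in> gram_kernels" "y \<in> gram_kernels"
  shows "x + y \<in> gram_kernels"
proof -
  obtain m :: nat and g where g: "\<And>k. k < m \<Longrightarrow> finite {j. g k j \<noteq> 0}"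
      "\<And>i j. Poly_Mapping.lookup x (i, j) = (\<Sum>k<m. adj (g k i) * g k j)"
    using assms(1) by (rule gram_kernelsE) (rule that)
  obtain n :: nat and h where h: "\<And>k. k < n \<Longrightarrow> finite {j. h k j \<noteq> 0}"
      "\<And>i j. Poly_Mapping.lookup y (i, j) = (\<Sum>k<n. adj (h k i) * h k j)"
    using assms(2) by (rule gram_kernelsE) (rule that)
  have split: "(\<Sum>k<m + n. f k) = (\<Sum>k<m. f k) + (\<Sum>k<n. f (m + k))" for f :: "nat \<Rightarrow> 'b"
    by (induction n) (simp_all add: add.assoc)
  define G where "G k = (if k < m then g k else h (k - m))" for k
  show ?thesis
  proof (rule gram_kernelsI[where m = "m + n" and g = G])
    show "finite {j. G k j \<noteq> 0}" if "k < m + n" for k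
      using g(1)[of k] h(1)[of "k - m"] that by (cases "k < m") (simp_all add: G_def)
    show "Poly_Mapping.lookup (x + y) (i, j) = (\<Sum>k<m + n. adj (G k i) * G k j)" for i j
      by (simp add: split G_def lookup_add g h)
  qed
qed

lemma gram_kernels_scale:
  assumes "x \<in> gram_kernels" "0 \<le> t"
  shows "complex_of_real t *\<^sub>C x \<in> gram_kernels"
proof -
  obtain m :: nat and g where g: "\<And>k. k < m \<Longrightarrow> finite {j. g k j \<noteq> 0}"
      "\<And>i j. Poly_Mapping.lookup x (i, j) = (\<Sum>k<m. adj (g k i) * g k j)"
    using assms(1) by (rule gram_kernelsE) (rule that)
  show ?thesis
  proof (rule gram_kernelsI[where m = m and g = "\<lambda>k j. complex_of_real (sqrt t) *\<^sub>C g k j"])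
    show "finite {j. complex_of_real (sqrt t) *\<^sub>C g k j \<noteq> 0}" if "k < m" for k
      using g(1)[OF that] by (rule finite_subset[rotated]) auto
    show "Poly_Mapping.lookup (complex_of_real t *\<^sub>C x) (i, j)
        = (\<Sum>k<m. adj (complex_of_real (sqrt t) *\<^sub>C g k i) * complex_of_real (sqrt t) *\<^sub>C g k j)" for i j
      using assms(2)
      by (simp add: lookup_scaleC g scaleC_sum_right adj_scaleC mult_scaleC_left mult_scaleC_right
          scaleC_scaleC flip: of_real_mult)
  qed
qed

lemma kernel_adj_gram: "x \<in> gram_kernels \<Longrightarrow> kernel_adj x = x"
  unfolding gram_kernels_def
  by (auto intro!: poly_mapping_eqI simp: lookup_kernel_adj adj_sum adj_mult adj_adj)

lemma sum_singles: "x = (\<Sum>k\<in>Poly_Mapping.keys x. Poly_Mapping.single k (Poly_Mapping.lookup x k))"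
  by (rule poly_mapping_eqI) (simp add: lookup_sum lookup_single when_def in_keys_iff sum.delta)

text \<open>For the elementary kernel with entry \<open>a\<close> at \<open>(i, j)\<close> this is the identity
  \<open>(e\<^sub>i + a e\<^sub>j)\<^sup>* (e\<^sub>i + a e\<^sub>j) + (t - a\<^sup>* a) e\<^sub>j\<^sup>* e\<^sub>j = e\<^sub>i\<^sup>* e\<^sub>i + t e\<^sub>j\<^sup>* e\<^sub>j + (e\<^sub>i\<^sup>* a e\<^sub>j + e\<^sub>j\<^sup>* a\<^sup>* e\<^sub>i)\<close>,
  with \<open>t\<close> so large that \<open>t - a\<^sup>* a\<close> has a root.\<close>

lemma gram_kernels_cofinal_single:
  fixes a :: "'a::unital_cstar_algebra" and i j :: 'j
  shows "\<exists>t\<ge>0. Poly_Mapping.single (i, i) 1 + Poly_Mapping.single (j, j) (complex_of_real t *\<^sub>C 1)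
    + (Poly_Mapping.single (i, j) a + kernel_adj (Poly_Mapping.single (i, j) a)) \<in> gram_kernels"
proof -
  obtain t b where t: "0 \<le> t" and b: "complex_of_real t *\<^sub>C 1 - adj a * a = adj b * b"
    using norm_square_minus[of a] by blast
  have tb: "complex_of_real t *\<^sub>C 1 = adj a * a + adj b * b" by (simp flip: b)
  define e where "e v k l = (if l = k then v else 0)" for k l :: 'j and v :: 'a
  define g where "g n l = (if n = 0 then e 1 i l + e a j l else e b j l)" for n :: nat and l
  have "Poly_Mapping.single (i, i) 1 + Poly_Mapping.single (j, j) (complex_of_real t *\<^sub>C 1)
    + (Poly_Mapping.single (i, j) a + kernel_adj (Poly_Mapping.single (i, j) a)) \<in> gram_kernels"
  proof (rule gram_kernelsI[where m = 2 and g = g])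
    show "finite {l. g k l \<noteq> 0}" for k
      by (rule finite_subset[of _ "{i, j}"]) (auto simp: g_def e_def)
    show "Poly_Mapping.lookup (Poly_Mapping.single (i, i) 1 + Poly_Mapping.single (j, j) (complex_of_real t *\<^sub>C 1)
        + (Poly_Mapping.single (i, j) a + kernel_adj (Poly_Mapping.single (i, j) a))) (p, q)
      = (\<Sum>k<2. adj (g k p) * g k q)" for p q
      by (cases "p = i"; cases "q = i"; cases "p = j"; cases "q = j")
        (simp_all add: lookup_add lookup_single lookup_kernel_adj tb g_def e_def when_def
          numeral_2_eq_2 adj_add algebra_simps)
  qed
  then show ?thesis using t by blast
qed

lemma gram_single: "Poly_Mapping.single (i, i) (adj b * b) \<in> gram_kernels"
proof (rule gram_kernelsI[where m = "Suc 0" and g = "\<lambda>_ l. if l = i then b else 0"])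
  show "finite {l. (if l = i then b else 0) \<noteq> 0}" by (rule finite_subset[of _ "{i}"]) auto
qed (auto simp: lookup_single when_def lessThan_Suc)

lemma gram_zero: "0 \<in> gram_kernels"
  by (rule gram_kernelsI[where m = 0]) auto

lemma kernel_adj_add: "kernel_adj (x + y) = kernel_adj x + kernel_adj y"
  by (rule poly_mapping_eqI) (auto simp: lookup_kernel_adj lookup_add adj_add)

definition scalar_valued :: "('j \<times> 'j \<Rightarrow>\<^sub>0 'a::unital_cstar_algebra) \<Rightarrow> bool" where
  "scalar_valued x \<longleftrightarrow> (\<forall>k. \<exists>c. Poly_Mapping.lookup x k = c *\<^sub>C 1)"

text \<open>The majorants of the single entries add up over the finite support. They have scalar
  entries, hence belong to the matrices over every operator system.\<close>

lemma gram_kernels_cofinal: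
  "\<exists>m. scalar_valued m \<and> m \<in> gram_kernels \<and> m + (x + kernel_adj x) \<in> gram_kernels"
proof -
  have zero: "kernel_adj 0 = 0" using kernel_adj_add[of 0 0] by simp
  have "\<exists>m. scalar_valued m \<and> m \<in> gram_kernels \<and>
    m + ((\<Sum>k\<in>F. Poly_Mapping.single k (Poly_Mapping.lookup x k)) + kernel_adj (\<Sum>k\<in>F. Poly_Mapping.single k (Poly_Mapping.lookup x k)))
      \<in> gram_kernels" if "finite F" for F
    using that
  proof induction
    case empty
    have "scalar_valued 0" by (auto simp: scalar_valued_def intro: exI[of _ 0])
    then show ?case using gram_zero by (intro exI[of _ 0]) (simp add: zero)
  next
    case (insert k F)
    let ?s = "\<Sum>k\<in>F. Poly_Mapping.single k (Poly_Mapping.lookup x k)"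
    obtain m where m: "scalar_valued m" "m \<in> gram_kernels" "m + (?s + kernel_adj ?s) \<in> gram_kernels"
      using insert by blast
    obtain i j where k: "k = (i, j)" by (cases k)
    let ?a = "Poly_Mapping.lookup x k"
    obtain t where t: "0 \<le> t" and P: "Poly_Mapping.single (i, i) 1 + Poly_Mapping.single (j, j) (complex_of_real t *\<^sub>C 1)
        + (Poly_Mapping.single (i, j) ?a + kernel_adj (Poly_Mapping.single (i, j) ?a)) \<in> gram_kernels"
      using gram_kernels_cofinal_single[of i j ?a] by (elim exE conjE)
    let ?m = "Poly_Mapping.single (i, i) (1::'b) + Poly_Mapping.single (j, j) (complex_of_real t *\<^sub>C 1)"
    have "adj (complex_of_real (sqrt t) *\<^sub>C 1) * (complex_of_real (sqrt t) *\<^sub>C 1) = complex_of_real t *\<^sub>C (1::'b)"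
      using t by (simp add: adj_scaleC mult_scaleC_left mult_scaleC_right scaleC_scaleC flip: of_real_mult)
    then have "?m \<in> gram_kernels"
      using gram_single[of i "1::'b"] gram_single[of j "complex_of_real (sqrt t) *\<^sub>C (1::'b)"]
      by (intro gram_kernels_add) (simp_all only: adj_one mult_1)
    moreover have "scalar_valued (?m + m)"
      unfolding scalar_valued_def
    proof
      fix l
      obtain c where "Poly_Mapping.lookup m l = c *\<^sub>C 1" using m(1) unfolding scalar_valued_def by blast
      then have "Poly_Mapping.lookup (?m + m) l = ((1 when l = (i, i)) + (complex_of_real t when l = (j, j)) + c) *\<^sub>C 1"
        by (auto simp: lookup_add lookup_single when_def scaleC_add_left scaleC_one)
      then show "\<exists>c. Poly_Mapping.lookup (?m + m) l = c *\<^sub>C 1" by blast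
    qed
    moreover have "(?m + m) + ((\<Sum>k\<in>insert k F. Poly_Mapping.single k (Poly_Mapping.lookup x k))
        + kernel_adj (\<Sum>k\<in>insert k F. Poly_Mapping.single k (Poly_Mapping.lookup x k))) \<in> gram_kernels"
      using gram_kernels_add[OF P m(3)] insert.hyps
      by (simp add: kernel_adj_add k algebra_simps)
    ultimately show ?case using m(2) gram_kernels_add by blast
  qed
  from this[OF finite_keys[of x]] show ?thesis using sum_singles[of x] by simp
qed

section \<open>Positive scalar kernels and their extension from an operator system\<close>

locale positive_kernel =
  fixes T :: "'j \<Rightarrow> 'j \<Rightarrow> 'a::unital_cstar_algebra \<Rightarrow> complex"
  assumes T_add: "T i j (a + b) = T i j a + T i j b"
    and T_scale: "T i j (c *\<^sub>C a) = c * T i j a"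
    and T_pos: "finite G \<Longrightarrow> (\<Sum>i\<in>G. \<Sum>j\<in>G. T i j (\<Sum>k<m::nat. adj (g k i) * g k j)) \<in> \<real>\<^sub>\<ge>\<^sub>0"

text \<open>Krein's theorem with the matrices over \<open>S\<close> as subspace; \<open>T\<close> is
  read off at single entries. In \<open>pos\<close> only the Gram sums lie in \<open>S\<close>,
  because an element of the cone can have entries in \<open>S\<close> without its factors lying
  there.\<close>

theorem kernel_extension:
  fixes S :: "'a::unital_cstar_algebra set" and T\<^sub>0 :: "'j \<Rightarrow> 'j \<Rightarrow> 'a \<Rightarrow> complex"
  assumes S: "operator_system S"
    and add: "\<And>i j a b. a \<in> S \<Longrightarrow> b \<in> S \<Longrightarrow> T\<^sub>0 i j (a + b) = T\<^sub>0 i j a + T\<^sub>0 i j b"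
    and scale: "\<And>i j a c. a \<in> S \<Longrightarrow> T\<^sub>0 i j (c *\<^sub>C a) = c * T\<^sub>0 i j a"
    and pos: "\<And>G (m::nat) g. finite G \<Longrightarrow>
      (\<And>i j. i \<in> G \<Longrightarrow> j \<in> G \<Longrightarrow> (\<Sum>k<m. adj (g k i) * g k j) \<in> S) \<Longrightarrow>
      (\<Sum>i\<in>G. \<Sum>j\<in>G. T\<^sub>0 i j (\<Sum>k<m. adj (g k i) * g k j)) \<in> \<real>\<^sub>\<ge>\<^sub>0"
  shows "\<exists>T. positive_kernel T \<and> (\<forall>i j. \<forall>a\<in>S. T i j a = T\<^sub>0 i j a)"
proof -
  have S0: "0 \<in> S" using S unfolding operator_system_def by (metis scaleC_zero_left)
  have T00: "T\<^sub>0 i j 0 = 0" for i j using scale[OF S0, of i j 0] by simp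
  define M where "M = {x :: 'j \<times> 'j \<Rightarrow>\<^sub>0 'a. \<forall>k. Poly_Mapping.lookup x k \<in> S}"
  define s where "s x = (\<Sum>(i, j)\<in>Poly_Mapping.keys x. T\<^sub>0 i j (Poly_Mapping.lookup x (i, j)))" for x :: "'j \<times> 'j \<Rightarrow>\<^sub>0 'a"
  \<comment> \<open>As \<open>T\<^sub>0\<close> vanishes at \<open>0\<close>, any finite superset of
    the support may be summed over, so that different matrices are compared on a common set.\<close>
  have s_on: "s x = (\<Sum>(i, j)\<in>F. T\<^sub>0 i j (Poly_Mapping.lookup x (i, j)))" if "finite F" "Poly_Mapping.keys x \<subseteq> F" for x F
    unfolding s_def by (rule sum.mono_neutral_left) (use that T00 in \<open>auto simp: in_keys_iff\<close>)
  have "\<exists>f. (\<forall>x y. f (x + y) = f x + f y) \<and> (\<forall>c x. f (c *\<^sub>C x) = c * f x) \<and>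
    (\<forall>x\<in>M. f x = s x) \<and> (\<forall>x\<in>gram_kernels. f x \<in> \<real>\<^sub>\<ge>\<^sub>0)"
  proof (rule positive_extension[where star = kernel_adj])
    show "kernel_adj (c *\<^sub>C x) = cnj c *\<^sub>C kernel_adj x" for c and x :: "'j \<times> 'j \<Rightarrow>\<^sub>0 'a"
      by (rule poly_mapping_eqI) (auto simp: lookup_kernel_adj lookup_scaleC adj_scaleC)
    show "kernel_adj (kernel_adj x) = x" for x :: "'j \<times> 'j \<Rightarrow>\<^sub>0 'a"
      by (rule poly_mapping_eqI) (auto simp: lookup_kernel_adj adj_adj)
    show "x + y \<in> M" if "x \<in> M" "y \<in> M" for x y
      using that S by (auto simp: M_def lookup_add operator_system_def)
    show "c *\<^sub>C x \<in> M" if "x \<in> M" for c x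
      using that S by (auto simp: M_def lookup_scaleC operator_system_def)
    show "kernel_adj x \<in> M" if "x \<in> M" for x
      using that S by (auto simp: M_def lookup_kernel_adj operator_system_def)
    show "0 \<in> M" using S0 by (simp add: M_def)
    show "\<exists>m. m \<in> M \<and> m \<in> gram_kernels \<and> m + (x + kernel_adj x) \<in> gram_kernels" for x
    proof -
      obtain m where m: "scalar_valued m" "m \<in> gram_kernels" "m + (x + kernel_adj x) \<in> gram_kernels"
        using gram_kernels_cofinal[of x] by (elim exE conjE)
      have "Poly_Mapping.lookup m k \<in> S" for k
        using m(1) S unfolding scalar_valued_def operator_system_def by metis
      then show ?thesis using m(2,3) by (auto simp: M_def)
    qed
    show "s (x + y) = s x + s y" if "x \<in> M" "y \<in> M" for x y
    proof -
      have "Poly_Mapping.keys (x + y) \<subseteq> Poly_Mapping.keys x \<union> Poly_Mapping.keys y" by (rule keys_add)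
      then show ?thesis
        using that
        by (simp add: s_on[of "Poly_Mapping.keys x \<union> Poly_Mapping.keys y"] lookup_add M_def add split_beta flip: sum.distrib)
    qed
    show "s (c *\<^sub>C x) = c * s x" if "x \<in> M" for c x
    proof -
      have "Poly_Mapping.keys (c *\<^sub>C x) \<subseteq> Poly_Mapping.keys x" by (auto simp: in_keys_iff lookup_scaleC)
      then show ?thesis
        using that
        by (simp add: s_on[of "Poly_Mapping.keys x"] lookup_scaleC M_def scale split_beta sum_distrib_left)
    qed
    show "s x \<in> \<real>\<^sub>\<ge>\<^sub>0" if x: "x \<in> M" "x \<in> gram_kernels" for x
    proof -
      obtain m :: nat and g where
        g: "\<And>k. k < m \<Longrightarrow> finite {j. g k j \<noteq> 0}" "\<And>i j. Poly_Mapping.lookup x (i, j) = (\<Sum>k<m. adj (g k i) * g k j)"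
        using x(2) by (rule gram_kernelsE) (rule that)
      define G where "G = fst ` Poly_Mapping.keys x \<union> snd ` Poly_Mapping.keys x"
      have G: "finite G" "Poly_Mapping.keys x \<subseteq> G \<times> G" by (force simp: G_def)+
      have "s x = (\<Sum>i\<in>G. \<Sum>j\<in>G. T\<^sub>0 i j (Poly_Mapping.lookup x (i, j)))"
        using G by (simp add: s_on[of "G \<times> G"] sum.cartesian_product)
      also have "\<dots> = (\<Sum>i\<in>G. \<Sum>j\<in>G. T\<^sub>0 i j (\<Sum>k<m. adj (g k i) * g k j))" by (simp add: g)
      also have "\<dots> \<in> \<real>\<^sub>\<ge>\<^sub>0"
        by (rule pos[OF G(1)]) (use x(1) in \<open>simp add: M_def flip: g(2)\<close>)
      finally show ?thesis .
    qed
  qed (simp_all add: kernel_adj_add gram_kernels_add gram_kernels_scale gram_zero kernel_adj_gram)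
  then obtain f where f: "\<And>x y. f (x + y) = f x + f y" "\<And>c x. f (c *\<^sub>C x) = c * f x"
    and fM: "\<And>x. x \<in> M \<Longrightarrow> f x = s x" and fP: "\<And>x. x \<in> gram_kernels \<Longrightarrow> f x \<in> \<real>\<^sub>\<ge>\<^sub>0" by blast
  have f0: "f 0 = 0" using f(1)[of 0 0] by simp
  have f_sum: "f (\<Sum>i\<in>I. x i) = (\<Sum>i\<in>I. f (x i))" for I :: "'j set" and x
    by (induction I rule: infinite_finite_induct) (simp_all add: f f0)
  define T where "T i j a = f (Poly_Mapping.single (i, j) a)" for i j a
  have "positive_kernel T"
  proof
    show "T i j (a + b) = T i j a + T i j b" for i j a b by (simp add: T_def single_add f)
    have "Poly_Mapping.single k (c *\<^sub>C a) = c *\<^sub>C Poly_Mapping.single k a" for k :: "'j \<times> 'j" and c and a :: 'a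
      by (rule poly_mapping_eqI) (simp add: lookup_scaleC lookup_single when_def)
    then show "T i j (c *\<^sub>C a) = c * T i j a" for i j c a by (simp add: T_def f)
    fix G :: "'j set" and m :: nat and g :: "nat \<Rightarrow> 'j \<Rightarrow> 'a" assume G: "finite G"
    let ?c = "\<lambda>i j. \<Sum>k<m. adj (g k i) * g k j"
    let ?x = "\<Sum>i\<in>G. \<Sum>j\<in>G. Poly_Mapping.single (i, j) (?c i j)"
    have "?x \<in> gram_kernels"
    \<comment> \<open>Truncation to \<open>G\<close> makes the factors finitely supported and keeps
      the entries over \<open>G\<close>.\<close>
    proof (rule gram_kernelsI[where m = m and g = "\<lambda>k i. if i \<in> G then g k i else 0"])
      show "finite {j. (if j \<in> G then g k j else 0) \<noteq> 0}" for k
        by (rule finite_subset[OF _ G]) auto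
      show "Poly_Mapping.lookup ?x (p, q) = (\<Sum>k<m. adj (if p \<in> G then g k p else 0) * (if q \<in> G then g k q else 0))" for p q
      proof -
        have "Poly_Mapping.lookup ?x (p, q) = (\<Sum>i\<in>G. if i = p then \<Sum>j\<in>G. if j = q then ?c i j else 0 else 0)"
          by (auto simp: lookup_sum lookup_single when_def intro!: sum.cong sum.neutral)
        then show ?thesis using G by (simp add: sum.delta)
      qed
    qed
    then show "(\<Sum>i\<in>G. \<Sum>j\<in>G. T i j (?c i j)) \<in> \<real>\<^sub>\<ge>\<^sub>0"
      using fP[of ?x] by (simp add: T_def f_sum)
  qed
  moreover have "T i j a = T\<^sub>0 i j a" if "a \<in> S" for i j a
  proof -
    have "Poly_Mapping.single (i, j) a \<in> M" using that S0 by (simp add: M_def lookup_single when_def)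
    then show ?thesis by (simp add: T_def fM s_on[of "{(i, j)}"])
  qed
  ultimately show ?thesis by blast
qed

text \<open>The discriminant argument for a positive form on two vectors, with \<open>l\<close> the
  coefficient of the second one. The values \<open>l = 1\<close> and \<open>l = \<i>\<close> force
  hermitian symmetry, and \<open>l = - r * cnj z\<close> with real \<open>r\<close> leaves a real
  quadratic in \<open>r\<close>.\<close>

lemma gram_quadratic_bound:
  fixes A B z w :: complex
  assumes nonneg: "\<And>l. A + l * z + cnj l * w + cnj l * l * B \<in> \<real>\<^sub>\<ge>\<^sub>0" and B: "B \<in> \<real>\<^sub>\<ge>\<^sub>0"
  shows "w = cnj z" and "(cmod z)\<^sup>2 \<le> Re A * Re B"
proof -
  have A: "A \<in> \<real>\<^sub>\<ge>\<^sub>0" using nonneg[of 0] by simp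
  have "Im (z + w) = 0" using nonneg[of 1] A B by (simp add: complex_nonneg_Reals_iff)
  moreover have "Im (\<i> * (z - w)) = 0" using nonneg[of \<i>] A B by (simp add: complex_nonneg_Reals_iff)
  ultimately show w: "w = cnj z" by (simp add: complex_eq_iff)
  have q: "0 \<le> Re A - 2 * r * (cmod z)\<^sup>2 + r\<^sup>2 * (cmod z)\<^sup>2 * Re B" for r :: real
  proof -
    obtain b where b: "B = complex_of_real b" using B by (metis complex_nonneg_Reals_iff complex_is_Real_iff Reals_cases)
    let ?l = "- complex_of_real r * cnj z"
    have "A + ?l * z + cnj ?l * w + cnj ?l * ?l * B
        = A + complex_of_real (- 2 * r) * (z * cnj z) + complex_of_real (r\<^sup>2 * b) * (z * cnj z)"
      by (simp add: w b power2_eq_square algebra_simps)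
    also have "\<dots> = A + complex_of_real (- 2 * r * (cmod z)\<^sup>2 + r\<^sup>2 * (cmod z)\<^sup>2 * Re B)"
      unfolding complex_norm_square[symmetric] b by (simp add: algebra_simps)
    finally have "A + complex_of_real (- 2 * r * (cmod z)\<^sup>2 + r\<^sup>2 * (cmod z)\<^sup>2 * Re B) \<in> \<real>\<^sub>\<ge>\<^sub>0"
      using nonneg[of ?l] by (simp only:)
    then show ?thesis by (simp add: complex_nonneg_Reals_iff flip: of_real_power)
  qed
  have A0: "0 \<le> Re A" and B0: "0 \<le> Re B" using A B by (auto simp: complex_nonneg_Reals_iff)
  show "(cmod z)\<^sup>2 \<le> Re A * Re B"
  proof (cases "Re B = 0")
    case True
    have "z = 0"
    proof (rule ccontr)
      assume "z \<noteq> 0"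
      \<comment> \<open>With \<open>Re B = 0\<close> the quadratic degenerates to an affine function
        of \<open>r\<close>, and this \<open>r\<close> is large enough to make it negative.\<close>
      then have "Re A - 2 * ((Re A + 1) / (cmod z)\<^sup>2) * (cmod z)\<^sup>2 = - Re A - 2" by simp
      then show False using q[of "(Re A + 1) / (cmod z)\<^sup>2"] A0 True by simp
    qed
    then show ?thesis using A0 B0 by simp
  next
    case False
    \<comment> \<open>The quadratic is minimal at \<open>r = 1 / Re B\<close>.\<close>
    then show ?thesis using q[of "1 / Re B"] B0 by (simp add: field_simps power2_eq_square)
  qed
qed

section \<open>Cauchy--Schwarz inequality, null vectors and bounds\<close>

context positive_kernel
begin

lemma T_zero [simp]: "T i j 0 = 0"
  using T_scale[of i j 0 0] by simp

lemma T_sum: "T i j (\<Sum>k\<in>F. f k) = (\<Sum>k\<in>F. T i j (f k))"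
  by (induction F rule: infinite_finite_induct) (simp_all add: T_add)

text \<open>Positions carrying the same index are merged by adding their coefficients. Families with
  repetitions arise when an extra vector is adjoined to a combination and when ampliations are
  unfolded.\<close>

lemma T_pos_family:
  fixes m :: nat and \<iota> :: "'s \<Rightarrow> 'j"
  assumes I: "finite I"
  shows "(\<Sum>s\<in>I. \<Sum>s'\<in>I. T (\<iota> s) (\<iota> s') (\<Sum>k<m. adj (g k s) * g k s')) \<in> \<real>\<^sub>\<ge>\<^sub>0"
proof -
  define f where "f k i = (\<Sum>s\<in>{s \<in> I. \<iota> s = i}. g k s)" for k :: nat and i
  have gen: "sum h I = (\<Sum>i\<in>\<iota> ` I. sum h {s \<in> I. \<iota> s = i})" for h :: "'s \<Rightarrow> complex"
    by (rule sum.image_gen[OF I])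
  have "(\<Sum>s\<in>I. \<Sum>s'\<in>I. T (\<iota> s) (\<iota> s') (\<Sum>k<m. adj (g k s) * g k s'))
    = (\<Sum>s\<in>I. \<Sum>j\<in>\<iota> ` I. \<Sum>s'\<in>{s' \<in> I. \<iota> s' = j}. T (\<iota> s) (\<iota> s') (\<Sum>k<m. adj (g k s) * g k s'))"
    by (intro sum.cong refl gen)
  also have "\<dots> = (\<Sum>i\<in>\<iota> ` I. \<Sum>s\<in>{s \<in> I. \<iota> s = i}. \<Sum>j\<in>\<iota> ` I. \<Sum>s'\<in>{s' \<in> I. \<iota> s' = j}.
        T (\<iota> s) (\<iota> s') (\<Sum>k<m. adj (g k s) * g k s'))"
    by (rule gen)
  also have "\<dots> = (\<Sum>i\<in>\<iota> ` I. \<Sum>j\<in>\<iota> ` I. \<Sum>s\<in>{s \<in> I. \<iota> s = i}. \<Sum>s'\<in>{s' \<in> I. \<iota> s' = j}.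
        T i j (\<Sum>k<m. adj (g k s) * g k s'))"
    by (intro sum.cong refl, subst sum.swap) (auto intro!: sum.cong)
  also have "\<dots> = (\<Sum>i\<in>\<iota> ` I. \<Sum>j\<in>\<iota> ` I. T i j (\<Sum>k<m. adj (f k i) * f k j))"
  proof (intro sum.cong refl)
    fix i j
    have "(\<Sum>k<m. adj (f k i) * f k j)
      = (\<Sum>s\<in>{s \<in> I. \<iota> s = i}. \<Sum>s'\<in>{s' \<in> I. \<iota> s' = j}. \<Sum>k<m. adj (g k s) * g k s')"
      by (simp add: f_def adj_sum sum_product sum.swap[of _ "{..<m}"])
    then show "(\<Sum>s\<in>{s \<in> I. \<iota> s = i}. \<Sum>s'\<in>{s' \<in> I. \<iota> s' = j}. T i j (\<Sum>k<m. adj (g k s) * g k s'))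
      = T i j (\<Sum>k<m. adj (f k i) * f k j)" by (simp add: T_sum)
  qed
  also have "\<dots> \<in> \<real>\<^sub>\<ge>\<^sub>0" using I by (intro T_pos) simp
  finally show ?thesis .
qed

text \<open>Positivity is applied to the index \<open>i\<close> with coefficient
  \<open>adj a\<close> joined to the combination \<open>c\<close> scaled by \<open>l\<close>. The
  combination has scalar coefficients, so its own squared length sees \<open>T\<close> only at
  \<open>1\<close>.\<close>

lemma
  fixes \<iota> :: "'s \<Rightarrow> 'j" and c :: "'s \<Rightarrow> complex"
  assumes I: "finite I"
  shows T_hermitian_family: "(\<Sum>s\<in>I. cnj (c s) * T (\<iota> s) i (adj a)) = cnj (\<Sum>s\<in>I. c s * T i (\<iota> s) a)"
    and T_cauchy_schwarz: "(cmod (\<Sum>s\<in>I. c s * T i (\<iota> s) a))\<^sup>2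
      \<le> Re (T i i (a * adj a)) * Re (\<Sum>s\<in>I. \<Sum>s'\<in>I. cnj (c s) * c s' * T (\<iota> s) (\<iota> s') 1)"
proof -
  let ?z = "\<Sum>s\<in>I. c s * T i (\<iota> s) a" and ?w = "\<Sum>s\<in>I. cnj (c s) * T (\<iota> s) i (adj a)"
    and ?B = "\<Sum>s\<in>I. \<Sum>s'\<in>I. cnj (c s) * c s' * T (\<iota> s) (\<iota> s') 1"
  have *: "T i i (a * adj a) + l * ?z + cnj l * ?w + cnj l * l * ?B \<in> \<real>\<^sub>\<ge>\<^sub>0" for l
  proof -
    \<comment> \<open>The position \<open>None\<close> stays separate from the family even if
      \<open>i\<close> also occurs as some \<open>\<iota> s\<close>.\<close>
    define g where "g k x = (case x of None \<Rightarrow> adj a | Some s \<Rightarrow> (l * c s) *\<^sub>C 1)" for k :: nat and x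
    define \<kappa> where "\<kappa> x = (case x of None \<Rightarrow> i | Some s \<Rightarrow> \<iota> s)" for x
    have "(\<Sum>s\<in>insert None (Some ` I). \<Sum>s'\<in>insert None (Some ` I).
        T (\<kappa> s) (\<kappa> s') (\<Sum>k<Suc 0. adj (g k s) * g k s')) \<in> \<real>\<^sub>\<ge>\<^sub>0"
      by (rule T_pos_family) (use I in simp)
    also have "(\<Sum>s\<in>insert None (Some ` I). \<Sum>s'\<in>insert None (Some ` I).
        T (\<kappa> s) (\<kappa> s') (\<Sum>k<Suc 0. adj (g k s) * g k s'))
      = T i i (a * adj a) + (\<Sum>s\<in>I. T i (\<iota> s) (a * (l * c s) *\<^sub>C 1))
        + (\<Sum>s\<in>I. T (\<iota> s) i (adj ((l * c s) *\<^sub>C 1) * adj a)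
          + (\<Sum>s'\<in>I. T (\<iota> s) (\<iota> s') (adj ((l * c s) *\<^sub>C 1) * (l * c s') *\<^sub>C 1)))"
      using I by (simp add: sum.reindex g_def \<kappa>_def adj_adj)
    also have "\<dots> = T i i (a * adj a) + l * ?z + cnj l * ?w + cnj l * l * ?B"
      by (simp add: adj_scaleC mult_scaleC_left mult_scaleC_right T_scale sum.distrib sum_distrib_left mult_ac)
    finally show ?thesis .
  qed
  have B: "?B \<in> \<real>\<^sub>\<ge>\<^sub>0"
    using T_pos_family[OF I, where \<iota> = \<iota> and m = "Suc 0" and g = "\<lambda>_ s. c s *\<^sub>C 1"]
    by (simp add: adj_scaleC mult_scaleC_left mult_scaleC_right T_scale mult_ac)
  show "?w = cnj ?z" by (rule gram_quadratic_bound(1)[OF * B])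
  show "(cmod ?z)\<^sup>2 \<le> Re (T i i (a * adj a)) * Re ?B" by (rule gram_quadratic_bound(2)[OF * B])
qed

lemma T_hermitian: "T j i (adj a) = cnj (T i j a)"
  using T_hermitian_family[of "{()}" "\<lambda>_. 1" "\<lambda>_. j" i a] by simp

text \<open>Linear relations between rows at the unit \<open>1\<close>, i.e. in the operator system, propagate to the whole
  algebra by the Cauchy--Schwarz inequality.\<close>

lemma T_relation:
  fixes \<iota> :: "'s \<Rightarrow> 'j" and \<kappa> :: "'t \<Rightarrow> 'j"
  assumes fin: "finite A" "finite B"
    and eq: "\<And>i. (\<Sum>s\<in>A. c s * T i (\<iota> s) 1) = (\<Sum>s\<in>B. d s * T i (\<kappa> s) 1)"
  shows "(\<Sum>s\<in>A. c s * T i (\<iota> s) a) = (\<Sum>s\<in>B. d s * T i (\<kappa> s) a)"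
proof -
  \<comment> \<open>Both sides become one combination over a disjoint sum. Its squared length
    vanishes by the hypothesis taken at every \<open>i = \<nu> s\<close>.\<close>
  define C where "C = case_sum c (\<lambda>s. - d s)"
  define \<nu> where "\<nu> = case_sum \<iota> \<kappa>"
  have *: "(\<Sum>s\<in>A <+> B. C s * T i (\<nu> s) a)
      = (\<Sum>s\<in>A. c s * T i (\<iota> s) a) - (\<Sum>s\<in>B. d s * T i (\<kappa> s) a)" for i a
    using fin by (simp add: sum.Plus C_def \<nu>_def sum_negf)
  have "(\<Sum>s\<in>A <+> B. \<Sum>s'\<in>A <+> B. cnj (C s) * C s' * T (\<nu> s) (\<nu> s') 1)
    = (\<Sum>s\<in>A <+> B. cnj (C s) * (\<Sum>s'\<in>A <+> B. C s' * T (\<nu> s) (\<nu> s') 1))"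
    by (simp add: sum_distrib_left mult.assoc)
  also have "\<dots> = 0" by (simp add: * eq)
  finally have "(cmod (\<Sum>s\<in>A <+> B. C s * T i (\<nu> s) a))\<^sup>2 \<le> 0"
    using T_cauchy_schwarz[of "A <+> B" C i \<nu> a] fin by simp
  then show ?thesis by (simp add: *)
qed

lemma T_relation_left:
  fixes \<iota> :: "'s \<Rightarrow> 'j" and \<kappa> :: "'t \<Rightarrow> 'j"
  assumes "\<And>a. (\<Sum>s\<in>A. c s * T i (\<iota> s) a) = (\<Sum>s\<in>B. d s * T i (\<kappa> s) a)"
  shows "(\<Sum>s\<in>A. cnj (c s) * T (\<iota> s) i a) = (\<Sum>s\<in>B. cnj (d s) * T (\<kappa> s) i a)"
proof -
  have "cnj (T i j (adj a)) = T j i a" for j using T_hermitian[of j i "adj a"] by (simp add: adj_adj)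
  then show ?thesis using arg_cong[OF assms[of "adj a"], of cnj] by simp
qed

text \<open>Cauchy--Schwarz with \<open>a * adj a\<close> majorised by \<open>t\<close> times the
  unit. The constant depends on \<open>a\<close> alone, and this uniformity in the indices later
  yields boundedness in the vectors.\<close>

lemma T_bound:
  "\<exists>t\<ge>0. \<forall>i j. (cmod (T i j a))\<^sup>2 \<le> t * Re (T i i 1) * Re (T j j 1)"
proof -
  obtain t b where t: "0 \<le> t" "complex_of_real t *\<^sub>C 1 - adj (adj a) * adj a = adj b * b"
    using norm_square_minus[of "adj a"] by blast
  have "(cmod (T i j a))\<^sup>2 \<le> t * Re (T i i 1) * Re (T j j 1)" for i j
  proof -
    have pos: "T i i (adj x * x) \<in> \<real>\<^sub>\<ge>\<^sub>0" for i x
      using T_pos[where G = "{i}" and m = "Suc 0" and g = "\<lambda>_ _. x"] by (simp add: lessThan_Suc)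
    have "a * adj a + adj b * b = complex_of_real t *\<^sub>C 1" by (simp add: adj_adj flip: t(2))
    then have "T i i (a * adj a) + T i i (adj b * b) = complex_of_real t * T i i 1"
      by (simp flip: T_add T_scale)
    then have "Re (T i i (a * adj a)) + Re (T i i (adj b * b)) = t * Re (T i i 1)"
      by (simp add: complex_eq_iff)
    then have "Re (T i i (a * adj a)) \<le> t * Re (T i i 1)"
      using pos[of i b] by (simp add: complex_nonneg_Reals_iff)
    moreover have "0 \<le> Re (T j j 1)" using pos[of j 1] by (simp add: complex_nonneg_Reals_iff)
    ultimately show ?thesis
      using T_cauchy_schwarz[of "{()}" "\<lambda>_. 1" i "\<lambda>_. j" a] mult_right_mono order_trans by fastforce
  qed
  then show ?thesis using t(1) by blast
qed

end

section \<open>Block matrices\<close>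

lemma offset_Suc: "i < length ns \<Longrightarrow> offset ns (Suc i) = offset ns i + ns ! i"
  by (simp add: offset_def take_Suc_conv_app_nth)

lemma offset_mono: "i \<le> j \<Longrightarrow> offset ns i \<le> offset ns j"
  by (metis le_add1 le_add_diff_inverse offset_def sum_list_append take_add)

lemma offset_add_less: "i < length ns \<Longrightarrow> a < ns ! i \<Longrightarrow> offset ns i + a < sum_list ns"
  using offset_mono[of "Suc i" "length ns" ns] by (simp add: offset_Suc offset_def[of ns "length ns"])

lemma block_index_offset: "i < length ns \<Longrightarrow> a < ns ! i \<Longrightarrow> block_index ns (offset ns i + a) = i"
  unfolding block_index_def
proof (rule Least_equality)
  assume i: "i < length ns" "a < ns ! i"
  then show "offset ns i + a < offset ns (Suc i)" by (simp add: offset_Suc)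
  fix j assume "offset ns i + a < offset ns (Suc j)"
  then have "\<not> offset ns (Suc j) \<le> offset ns i" by linarith
  then have "\<not> Suc j \<le> i" using offset_mono by blast
  then show "i \<le> j" by simp
qed

lemma block_pos_offset: "i < length ns \<Longrightarrow> a < ns ! i \<Longrightarrow> block_pos ns (offset ns i + a) = a"
  by (simp add: block_pos_def block_index_offset)

lemma offset_decompose:
  "a < sum_list ns \<Longrightarrow> \<exists>i<length ns. \<exists>b<ns ! i. a = offset ns i + b"
proof (induction ns arbitrary: a)
  case (Cons n ns)
  show ?case
  proof (cases "a < n")
    case True
    then show ?thesis by (intro exI[of _ 0]) (auto simp: offset_def)
  next
    case False
    then have "a - n < sum_list ns" using Cons.prems by simp
    from Cons.IH[OF this] obtain i b where "i < length ns" "b < ns ! i" "a - n = offset ns i + b" by blast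
    then show ?thesis using False by (intro exI[of _ "Suc i"]) (auto simp: offset_def intro!: exI[of _ b])
  qed
qed simp

lemma
  assumes "a < sum_list ns"
  shows block_index_less: "block_index ns a < length ns"
    and block_pos_less: "block_pos ns a < ns ! block_index ns a"
  using offset_decompose[OF assms] by (auto simp: block_index_offset block_pos_offset)

lemma sum_blocks:
  "(\<Sum>a<sum_list ns. f a) = (\<Sum>i<length ns. \<Sum>b<ns ! i. f (offset ns i + b))"
proof -
  have "(\<Sum>a<sum_list ns. f a) = (\<Sum>(i, b)\<in>Sigma {..<length ns} (\<lambda>i. {..<ns ! i}). f (offset ns i + b))"
    by (rule sum.reindex_bij_witness[of _ "\<lambda>(i, b). offset ns i + b" "\<lambda>a. (block_index ns a, block_pos ns a)"])
      (auto simp: offset_add_less block_index_offset block_pos_offset block_index_less block_pos_less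
        dest!: offset_decompose)
  then show ?thesis by (simp add: sum.Sigma)
qed

lemma pos_alg_matI:
  assumes "\<And>a b. a < N \<Longrightarrow> b < N \<Longrightarrow> P a b = (\<Sum>k<N. adj (g k a) * g k b)"
  shows "pos_alg_mat N (mat N N (\<lambda>(a, b). P a b))"
proof -
  have "mat N N (\<lambda>(a, b). P a b)
    = map_mat adj (transpose_mat (mat N N (\<lambda>(k, a). g k a))) * mat N N (\<lambda>(k, a). g k a)"
    by (rule eq_matI) (simp_all add: assms scalar_prod_def atLeast0LessThan)
  then show ?thesis unfolding pos_alg_mat_def by (intro bexI) auto
qed

lemma pos_alg_matE:
  assumes "pos_alg_mat N P"
  obtains g where "P \<in> carrier_mat N N"
    "\<And>a b. a < N \<Longrightarrow> b < N \<Longrightarrow> P $$ (a, b) = (\<Sum>k<N. adj (g k a) * g k b)"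
proof -
  obtain B where "B \<in> carrier_mat N N" "P = map_mat adj (transpose_mat B) * B"
    using assms by (auto simp: pos_alg_mat_def)
  then show thesis
    by (intro that[of "\<lambda>k a. B $$ (k, a)"]) (auto simp: scalar_prod_def atLeast0LessThan)
qed

section \<open>Kernels in terms of matrix units\<close>

definition entry_mat :: "nat \<Rightarrow> nat \<Rightarrow> nat \<Rightarrow> nat \<Rightarrow> 'a::zero \<Rightarrow> 'a mat" where
  "entry_mat n m q q' a = mat n m (\<lambda>(i, j). if i = q \<and> j = q' then a else 0)"

lemma mats_iff: "P \<in> mats X n m \<longleftrightarrow> P \<in> carrier_mat n m \<and> (\<forall>i<n. \<forall>j<m. P $$ (i, j) \<in> X)"
  unfolding mats_def elements_mat_def by (auto simp: UN_subset_iff image_subset_iff)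

text \<open>Linearity is available only on matrices over \<open>X\<close>, so the entries are added
  one at a time; the partial matrices \<open>R F\<close>, filled up with zeros, stay inside
  \<open>mats X n m\<close>.\<close>

lemma graded_linear_entries:
  fixes L :: "'a::complex_vector mat \<Rightarrow> 'z::complex_vector mat"
  assumes L: "graded_linear X n m L" and X: "0 \<in> X" and P: "P \<in> mats X n m"
    and ij: "i < n" "j < m"
  shows "L P $$ (i, j) = (\<Sum>q<n. \<Sum>q'<m. L (entry_mat n m q q' (P $$ (q, q'))) $$ (i, j))"
proof -
  have Lc: "L Q \<in> carrier_mat n m" if "Q \<in> mats X n m" for Q using L that by (simp add: graded_linear_def)
  have add: "L (Q + R) = L Q + L R" if "Q \<in> mats X n m" "R \<in> mats X n m" for Q R
    using L that by (simp add: graded_linear_def)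
  define R where "R F = mat n m (\<lambda>k. if k \<in> F then P $$ k else 0)" for F
  have R: "R F \<in> mats X n m" for F using P X by (auto simp: R_def mats_iff)
  have E: "entry_mat n m q q' (P $$ (q, q')) \<in> mats X n m" if "q < n" "q' < m" for q q'
    using P X that by (auto simp: entry_mat_def mats_iff)
  have R0: "map_mat (scaleC 0) (R {}) = R {}" by (rule eq_matI) (simp_all add: R_def)
  have L0: "L (R {}) $$ (i, j) = 0"
  proof -
    have "L (map_mat (scaleC 0) (R {})) = map_mat (scaleC 0) (L (R {}))"
      using L R[of "{}"] unfolding graded_linear_def by blast
    then show ?thesis using Lc[OF R[of "{}"]] ij R0 by (metis carrier_matD index_map_mat(1) scaleC_zero_left)
  qed
  have "L (R F) $$ (i, j) = (\<Sum>(q, q')\<in>F. L (entry_mat n m q q' (P $$ (q, q'))) $$ (i, j))"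
    if "finite F" "F \<subseteq> {..<n} \<times> {..<m}" for F
    using that
  proof induction
    case (insert k F)
    obtain q q' where k: "k = (q, q')" by (cases k)
    have q: "q < n" "q' < m" using insert.prems k by auto
    have "R (insert k F) = R F + entry_mat n m q q' (P $$ (q, q'))"
      using insert.hyps by (intro eq_matI) (auto simp: R_def entry_mat_def k)
    then have "L (R (insert k F)) $$ (i, j)
        = L (R F) $$ (i, j) + L (entry_mat n m q q' (P $$ (q, q'))) $$ (i, j)"
      using add[OF R E[OF q]] Lc[OF E[OF q]] ij by simp
    then show ?case using insert by (simp add: k add.commute)
  qed (simp add: L0)
  from this[of "{..<n} \<times> {..<m}"] have "L (R ({..<n} \<times> {..<m})) $$ (i, j)
    = (\<Sum>q<n. \<Sum>q'<m. L (entry_mat n m q q' (P $$ (q, q'))) $$ (i, j))"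
    by (simp add: sum.cartesian_product)
  moreover have "R ({..<n} \<times> {..<m}) = P" using P by (intro eq_matI) (auto simp: R_def mats_iff)
  ultimately show ?thesis by simp
qed

lemma bop_eqI:
  assumes "\<And>u w. cinner (bop_apply A u) w = cinner (bop_apply B u) (w::'y::chilbert_space)"
  shows "A = B"
proof -
  have "bop_apply A = bop_apply B" by (rule ext, rule cinner_eqI) (rule assms)
  then show ?thesis by (simp add: bop_apply_inject)
qed

lemma bop_apply_plus: "bop_apply (A + B) u = bop_apply A u + bop_apply B u"
  by transfer simp

lemma bop_apply_scale: "bop_apply (c *\<^sub>C A) u = c *\<^sub>C bop_apply A u"
  by transfer simp

lemma bop_apply_0: "bop_apply 0 u = 0"
  by transfer simp

lemma bop_apply_sum: "bop_apply (\<Sum>i\<in>I. A i) u = (\<Sum>i\<in>I. bop_apply (A i) u)"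
  by (induction I rule: infinite_finite_induct) (simp_all add: bop_apply_plus bop_apply_0)

lemma bop_form_bound: "\<exists>C\<ge>0. \<forall>u. cmod (cinner (bop_apply A u) (u::'y::chilbert_space)) \<le> C * (norm u)\<^sup>2"
proof -
  have "bounded_linear (bop_apply A)" using bop_apply[of A] by simp
  then obtain C where C: "\<And>u. norm (bop_apply A u) \<le> norm u * C" "0 \<le> C"
    using bounded_linear.nonneg_bounded by blast
  have "cmod (cinner (bop_apply A u) u) \<le> C * (norm u)\<^sup>2" for u
    using order_trans[OF cinner_bound mult_right_mono[OF C(1) norm_ge_zero]]
    by (simp add: power2_eq_square mult_ac)
  then show ?thesis using C(2) by blast
qed

lemma lact_one: "Q \<in> carrier_mat n m \<Longrightarrow> 1\<^sub>m n *\<^sub>l Q = (Q :: 'b::complex_vector mat)"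
  by (intro eq_matI)
    (auto simp: lact_def if_distrib[of "\<lambda>c. c *\<^sub>C _"] sum.delta scaleC_one cong: if_cong)

lemma ract_one: "Q \<in> carrier_mat n m \<Longrightarrow> Q *\<^sub>r 1\<^sub>m m = (Q :: 'b::complex_vector mat)"
  by (intro eq_matI)
    (auto simp: ract_def if_distrib[of "\<lambda>c. c *\<^sub>C _"] sum.delta scaleC_one cong: if_cong)

section \<open>The extension of a completely positive kernel\<close>

locale cp_kernel =
  fixes \<Omega> :: "'v::complex_vector mat set"
    and S :: "'a::unital_cstar_algebra set"
    and K :: "'v mat \<Rightarrow> 'v mat \<Rightarrow> 'a mat \<Rightarrow> 'y::chilbert_space bop mat"
  assumes points: "\<Omega> \<subseteq> nc_space"
    and S: "operator_system S"
    and K: "cp_nc_kernel \<Omega> S K"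
begin

lemma S_one: "1 \<in> S" and S_add: "x \<in> S \<Longrightarrow> y \<in> S \<Longrightarrow> x + y \<in> S" and S_scale: "x \<in> S \<Longrightarrow> c *\<^sub>C x \<in> S"
  using S by (auto simp: operator_system_def)

lemma S_zero: "0 \<in> S"
  using S_scale[OF S_one, of 0] by simp

lemma square: "Z \<in> \<Omega> \<Longrightarrow> Z \<in> carrier_mat (dim_row Z) (dim_row Z)"
  using points by (auto simp: nc_space_def)

lemma K_linear: "Z \<in> \<Omega> \<Longrightarrow> W \<in> \<Omega> \<Longrightarrow> graded_linear S (dim_row Z) (dim_row W) (K Z W)"
  using K by (simp add: cp_nc_kernel_def nc_kernel_def)

lemma K_intertwine:
  assumes "Z \<in> \<Omega>" "Z' \<in> \<Omega>" "\<alpha> \<in> carrier_mat (dim_row Z') (dim_row Z)" "\<alpha> *\<^sub>l Z = Z' *\<^sub>r \<alpha>"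
    and "W \<in> \<Omega>" "W' \<in> \<Omega>" "\<beta> \<in> carrier_mat (dim_row W') (dim_row W)" "\<beta> *\<^sub>l W = W' *\<^sub>r \<beta>"
    and "P \<in> mats S (dim_row Z) (dim_row W)"
  shows "\<alpha> *\<^sub>l K Z W P *\<^sub>r ctranspose \<beta> = K Z' W' (\<alpha> *\<^sub>l P *\<^sub>r ctranspose \<beta>)"
  using K assms unfolding cp_nc_kernel_def nc_kernel_def by blast

lemma K_carrier: "Z \<in> \<Omega> \<Longrightarrow> W \<in> \<Omega> \<Longrightarrow> P \<in> mats S (dim_row Z) (dim_row W) \<Longrightarrow>
    K Z W P \<in> carrier_mat (dim_row Z) (dim_row W)"
  using K_linear by (simp add: graded_linear_def)

lemma entry_mats: "a \<in> S \<Longrightarrow> entry_mat n m q q' a \<in> mats S n m"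
  using S_zero by (auto simp: mats_iff entry_mat_def)

text \<open>An index \<open>(y, Z, p, q)\<close> stands for the vector \<open>y\<close> in the \<open>p\<close>-th coordinate of the target and the
  \<open>q\<close>-th coordinate of the argument of \<open>K Z _\<close>.\<close>

definition valid :: "'y \<times> 'v mat \<times> nat \<times> nat \<Rightarrow> bool" where
  "valid i = (case i of (y, Z, p, q) \<Rightarrow> Z \<in> \<Omega> \<and> p < dim_row Z \<and> q < dim_row Z)"

text \<open>The first index supplies the second argument of \<open>cinner\<close>, so the form is
  antilinear there, matching \<open>adj (g k i) * g k j\<close>. The default \<open>0\<close> makes
  the index set a full type without affecting positivity.\<close>

definition form :: "'y \<times> 'v mat \<times> nat \<times> nat \<Rightarrow> 'y \<times> 'v mat \<times> nat \<times> nat \<Rightarrow> 'a \<Rightarrow> complex" where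
  "form i j a = (if valid i \<and> valid j then
     (case i of (w, Z, p, q) \<Rightarrow> case j of (u, W, p', q') \<Rightarrow>
        cinner (bop_apply (K Z W (entry_mat (dim_row Z) (dim_row W) q q' a) $$ (p, p')) u) w)
     else 0)"

lemma form_eq:
  assumes "Z \<in> \<Omega>" "p < dim_row Z" "q < dim_row Z" "W \<in> \<Omega>" "p' < dim_row W" "q' < dim_row W"
  shows "form (w, Z, p, q) (u, W, p', q') a =
    cinner (bop_apply (K Z W (entry_mat (dim_row Z) (dim_row W) q q' a) $$ (p, p')) u) w"
  using assms by (simp add: form_def valid_def)

lemma form_invalid: "\<not> valid i \<or> \<not> valid j \<Longrightarrow> form i j a = 0"
  by (auto simp: form_def)

lemma form_add:
  assumes ab: "a \<in> S" "b \<in> S"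
  shows "form i j (a + b) = form i j a + form i j b"
proof (cases "valid i \<and> valid j")
  case True
  obtain w Z p q u W p' q' where ij: "i = (w, Z, p, q)" "j = (u, W, p', q')"
    by (metis surj_pair)
  have v: "Z \<in> \<Omega>" "p < dim_row Z" "q < dim_row Z" "W \<in> \<Omega>" "p' < dim_row W" "q' < dim_row W"
    using True by (auto simp: valid_def ij)
  let ?E = "entry_mat (dim_row Z) (dim_row W) q q'"
  have "?E (a + b) = ?E a + ?E b" by (rule eq_matI) (auto simp: entry_mat_def)
  then have "K Z W (?E (a + b)) = K Z W (?E a) + K Z W (?E b)"
    using K_linear[OF v(1,4)] entry_mats ab by (simp add: graded_linear_def)
  then show ?thesis
    using carrier_matD[OF K_carrier[OF v(1,4) entry_mats[OF ab(2)]]] v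
    by (simp add: ij form_eq bop_apply_plus cinner_add_left)
qed (simp add: form_invalid)

lemma form_scale:
  assumes a: "a \<in> S"
  shows "form i j (c *\<^sub>C a) = c * form i j a"
proof (cases "valid i \<and> valid j")
  case True
  obtain w Z p q u W p' q' where ij: "i = (w, Z, p, q)" "j = (u, W, p', q')"
    by (metis surj_pair)
  have v: "Z \<in> \<Omega>" "p < dim_row Z" "q < dim_row Z" "W \<in> \<Omega>" "p' < dim_row W" "q' < dim_row W"
    using True by (auto simp: valid_def ij)
  let ?E = "entry_mat (dim_row Z) (dim_row W) q q'"
  have "?E (c *\<^sub>C a) = map_mat (scaleC c) (?E a)" by (rule eq_matI) (auto simp: entry_mat_def)
  then have "K Z W (?E (c *\<^sub>C a)) = map_mat (scaleC c) (K Z W (?E a))"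
    using K_linear[OF v(1,4)] entry_mats a by (simp add: graded_linear_def)
  then show ?thesis
    using carrier_matD[OF K_carrier[OF v(1,4) entry_mats[OF a]]] v
    by (simp add: ij form_eq bop_apply_scale cinner_scaleC_left)
qed (simp add: form_invalid)

lemma form_zero: "form i j 0 = 0"
  using form_scale[OF S_zero, of i j 0] by simp

text \<open>Complete positivity is used only for the first ampliation of the lists of points.  The length of the
  list must be at least the number \<open>m\<close> of squares, since \<open>pos_alg_mat\<close> refers to square matrices.\<close>

lemma form_pos_list:
  fixes g :: "nat \<Rightarrow> nat \<Rightarrow> 'a"
  assumes js: "\<And>r. r < length js \<Longrightarrow> valid (js ! r)" and m: "m \<le> length js"
    and c: "\<And>r r'. r < length js \<Longrightarrow> r' < length js \<Longrightarrow> (\<Sum>k<m. adj (g k r) * g k r') \<in> S"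
  shows "(\<Sum>r<length js. \<Sum>r'<length js. form (js ! r) (js ! r') (\<Sum>k<m. adj (g k r) * g k r')) \<in> \<real>\<^sub>\<ge>\<^sub>0"
proof -
  let ?n = "length js"
  define u where "u r = fst (js ! r)" for r
  define Z where "Z r = fst (snd (js ! r))" for r
  define p where "p r = fst (snd (snd (js ! r)))" for r
  define q where "q r = snd (snd (snd (js ! r)))" for r
  have js_eq: "js ! r = (u r, Z r, p r, q r)" for r by (simp add: u_def Z_def p_def q_def)
  have v: "Z r \<in> \<Omega>" "p r < dim_row (Z r)" "q r < dim_row (Z r)" if "r < ?n" for r
    using js[OF that] by (auto simp: js_eq valid_def)
  \<comment> \<open>Every position of the list receives its own block, so indices over the same
    point do not collide.\<close>
  define Zs where "Zs = map Z [0..<?n]"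
  define ns where "ns = map dim_row Zs"
  define N where "N = sum_list ns"
  have Zs: "length Zs = ?n" "\<And>r. r < ?n \<Longrightarrow> Zs ! r = Z r" by (auto simp: Zs_def)
  have ns: "length ns = ?n" "\<And>r. r < ?n \<Longrightarrow> ns ! r = dim_row (Z r)" using Zs by (auto simp: ns_def)
  \<comment> \<open>Each point has size at least one because \<open>p r\<close> lies below it; thus
    \<open>N\<close> leaves room for \<open>m\<close> squares.\<close>
  have "(\<Sum>r<?n. 1) \<le> (\<Sum>r<?n. ns ! r)"
    by (rule sum_mono) (use v ns in fastforce)
  then have mN: "m \<le> N" using m by (simp add: N_def sum_list_sum_nth ns atLeast0LessThan)
  let ?c = "\<lambda>r r'. \<Sum>k<m. adj (g k r) * g k r'"
  let ?bi = "block_index ns" and ?bp = "block_pos ns"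
  \<comment> \<open>The coefficient for \<open>r\<close> and \<open>r'\<close> is put at position
    \<open>(q r, q r')\<close> of their block; the matrix is a Gram matrix since \<open>g k\<close>
    can be spread out in the same way.\<close>
  define P where "P a b = (if ?bp a = q (?bi a) \<and> ?bp b = q (?bi b) then ?c (?bi a) (?bi b) else 0)" for a b
  let ?P = "mat N N (\<lambda>(a, b). P a b)"
  have bi: "?bi a < ?n" if "a < N" for a using block_index_less[of a ns] that by (simp add: N_def ns)
  have "pos_alg_mat N ?P"
  proof (rule pos_alg_matI[where g = "\<lambda>k a. if k < m \<and> ?bp a = q (?bi a) then g k (?bi a) else 0"])
    fix a b
    have "P a b = (\<Sum>k<m. adj (if k < m \<and> ?bp a = q (?bi a) then g k (?bi a) else 0)
        * (if k < m \<and> ?bp b = q (?bi b) then g k (?bi b) else 0))"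
      by (auto simp: P_def intro!: sum.cong sum.neutral)
    also have "\<dots> = (\<Sum>k<N. adj (if k < m \<and> ?bp a = q (?bi a) then g k (?bi a) else 0)
        * (if k < m \<and> ?bp b = q (?bi b) then g k (?bi b) else 0))"
      by (rule sum.mono_neutral_left) (use mN in auto)
    finally show "P a b = \<dots>" .
  qed
  moreover have "?P \<in> mats S N N" using c bi S_zero by (auto simp: mats_iff P_def)
  moreover have "cp_map S N (blockwise ns (\<lambda>i j. K (Zs ! i) (Zs ! j)))"
  proof -
    have "set Zs \<subseteq> \<Omega>" using v by (auto simp: Zs_def)
    then show ?thesis using K unfolding cp_nc_kernel_def N_def ns_def by blast
  qed
  ultimately have pos: "pos_op_mat N (blockwise (replicate 1 N) (\<lambda>_ _. blockwise ns (\<lambda>i j. K (Zs ! i) (Zs ! j))) ?P)"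
    unfolding cp_map_def by (metis le_numeral_extra(4) mult_1)
  define \<Phi> where "\<Phi> = blockwise ns (\<lambda>i j. K (Zs ! i) (Zs ! j)) ?P"
  have single_block: "blockwise (replicate 1 N) (\<lambda>_ _. blockwise ns (\<lambda>i j. K (Zs ! i) (Zs ! j))) ?P = \<Phi>"
  proof -
    have b0: "block_index [N] a = 0" "block_pos [N] a = a" if "a < N" for a
      using block_index_offset[of 0 "[N]" a] block_pos_offset[of 0 "[N]" a] that by (simp_all add: offset_def)
    have "block [N] ?P 0 0 = ?P" by (rule eq_matI) (auto simp: block_def offset_def)
    then show ?thesis
      by (intro eq_matI) (auto simp: blockwise_def[of "[N]"] b0 \<Phi>_def blockwise_def[of ns] N_def[symmetric])
  qed
  \<comment> \<open>The test vector has \<open>u r\<close> in coordinate \<open>p r\<close> of block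
    \<open>r\<close>, so each pair of blocks contributes exactly one value of
    \<open>form\<close>.\<close>
  define y where "y = vec N (\<lambda>a. if ?bp a = p (?bi a) then u (?bi a) else 0)"
  have \<Phi>: "\<Phi> $$ (offset ns r + i, offset ns r' + j)
      = K (Z r) (Z r') (entry_mat (dim_row (Z r)) (dim_row (Z r')) (q r) (q r') (?c r r')) $$ (i, j)"
    if "r < ?n" "r' < ?n" "i < ns ! r" "j < ns ! r'" for r r' i j
  proof -
    have "block ns ?P r r' = entry_mat (dim_row (Z r)) (dim_row (Z r')) (q r) (q r') (?c r r')"
      using that by (intro eq_matI)
        (auto simp: block_def entry_mat_def ns P_def N_def offset_add_less block_index_offset block_pos_offset)
    moreover have "offset ns r + i < sum_list ns" "offset ns r' + j < sum_list ns"
      using that by (simp_all add: offset_add_less ns(1))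
    ultimately show ?thesis
      using that by (simp add: \<Phi>_def blockwise_def ns(1) block_index_offset block_pos_offset Zs)
  qed
  have y: "y $ (offset ns r + i) = (if i = p r then u r else 0)" if "r < ?n" "i < ns ! r" for r i
    using that offset_add_less[of r ns i]
    by (simp add: y_def N_def ns(1) block_index_offset block_pos_offset)
  have "(\<Sum>i<N. cinner (\<Sum>j<N. bop_apply (\<Phi> $$ (i, j)) (y $ j)) (y $ i)) \<in> \<real>\<^sub>\<ge>\<^sub>0"
    using pos unfolding pos_op_mat_def single_block by (elim conjE bspec) (simp add: y_def)
  also have "(\<Sum>i<N. cinner (\<Sum>j<N. bop_apply (\<Phi> $$ (i, j)) (y $ j)) (y $ i))
    = (\<Sum>i<N. \<Sum>j<N. cinner (bop_apply (\<Phi> $$ (i, j)) (y $ j)) (y $ i))"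
    by (simp add: cinner_sum_left)
  also have "\<dots> = (\<Sum>r<?n. \<Sum>i<ns ! r. \<Sum>r'<?n. \<Sum>j<ns ! r'.
      cinner (bop_apply (\<Phi> $$ (offset ns r + i, offset ns r' + j)) (y $ (offset ns r' + j))) (y $ (offset ns r + i)))"
    by (simp add: N_def sum_blocks ns(1))
  also have "\<dots> = (\<Sum>r<?n. \<Sum>r'<?n. form (js ! r) (js ! r') (?c r r'))"
  proof (rule sum.cong[OF refl])
    fix r assume "r \<in> {..<?n}"
    then have r: "r < ?n" by simp
    let ?t = "\<lambda>i r' j. cinner (bop_apply (\<Phi> $$ (offset ns r + i, offset ns r' + j)) (y $ (offset ns r' + j)))
      (y $ (offset ns r + i))"
    have "(\<Sum>i<ns ! r. \<Sum>r'<?n. \<Sum>j<ns ! r'. ?t i r' j)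
      = (\<Sum>i<ns ! r. if i = p r then \<Sum>r'<?n. form (js ! r) (js ! r') (?c r r') else 0)"
    proof (intro sum.cong refl)
      fix i assume "i \<in> {..<ns ! r}"
      then have i: "i < ns ! r" by simp
      have "(\<Sum>j<ns ! r'. ?t i r' j) = (if i = p r then form (js ! r) (js ! r') (?c r r') else 0)"
        if r': "r' < ?n" for r'
      proof -
        have "(\<Sum>j<ns ! r'. ?t i r' j)
          = (\<Sum>j<ns ! r'. if j = p r' then if i = p r then form (js ! r) (js ! r') (?c r r') else 0 else 0)"
          using r r' i v by (intro sum.cong refl) (auto simp: y \<Phi> js_eq form_eq ns)
        then show ?thesis using v[OF r'] ns(2)[OF r'] by (simp add: sum.delta)
      qed
      then show "(\<Sum>r'<?n. \<Sum>j<ns ! r'. ?t i r' j) = (if i = p r then \<Sum>r'<?n. form (js ! r) (js ! r') (?c r r') else 0)"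
        by simp
    qed
    also have "\<dots> = (\<Sum>r'<?n. form (js ! r) (js ! r') (?c r r'))"
      using v[OF r] ns(2)[OF r] by (simp add: sum.delta)
    finally show "(\<Sum>i<ns ! r. \<Sum>r'<?n. \<Sum>j<ns ! r'. ?t i r' j) = \<dots>" .
  qed
  finally show ?thesis .
qed

lemma form_pos:
  fixes g :: "nat \<Rightarrow> 'y \<times> 'v mat \<times> nat \<times> nat \<Rightarrow> 'a"
  assumes G: "finite G" and c: "\<And>i j. i \<in> G \<Longrightarrow> j \<in> G \<Longrightarrow> (\<Sum>k<m. adj (g k i) * g k j) \<in> S"
  shows "(\<Sum>i\<in>G. \<Sum>j\<in>G. form i j (\<Sum>k<m. adj (g k i) * g k j)) \<in> \<real>\<^sub>\<ge>\<^sub>0"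
proof -
  let ?c = "\<lambda>i j. \<Sum>k<m. adj (g k i) * g k j"
  define V where "V = {i \<in> G. valid i}"
  have V: "finite V" "V \<subseteq> G" using G by (auto simp: V_def)
  have "(\<Sum>i\<in>G. \<Sum>j\<in>G. form i j (?c i j)) = (\<Sum>i\<in>V. \<Sum>j\<in>G. form i j (?c i j))"
    by (rule sum.mono_neutral_right) (use G in \<open>auto simp: V_def form_invalid\<close>)
  also have "\<dots> = (\<Sum>i\<in>V. \<Sum>j\<in>V. form i j (?c i j))"
    by (intro sum.cong refl sum.mono_neutral_right) (use G in \<open>auto simp: V_def form_invalid\<close>)
  finally have GV: "(\<Sum>i\<in>G. \<Sum>j\<in>G. form i j (?c i j)) = (\<Sum>i\<in>V. \<Sum>j\<in>V. form i j (?c i j))" .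
  show ?thesis
  proof (cases "V = {}")
    case False
    obtain xs where xs: "set xs = V" "distinct xs" using finite_distinct_list[OF V(1)] by blast
    define l where "l = length xs"
    \<comment> \<open>Padding by \<open>m\<close> copies of a valid index makes the list long
      enough; \<open>h\<close> gives the copies coefficient \<open>0\<close>. The case of no valid
      index is separate because \<open>hd xs\<close> must exist.\<close>
    define js where "js = xs @ replicate m (hd xs)"
    define h where "h k r = (if r < l then g k (xs ! r) else 0)" for k r
    have "xs \<noteq> []" using False xs by auto
    then have "set js = V" using xs by (auto simp: js_def)
    have len: "length js = l + m" by (simp add: js_def l_def)
    have "(\<Sum>r<length js. \<Sum>r'<length js. form (js ! r) (js ! r') (\<Sum>k<m. adj (h k r) * h k r')) \<in> \<real>\<^sub>\<ge>\<^sub>0"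
    proof (rule form_pos_list)
      show "valid (js ! r)" if "r < length js" for r
        using nth_mem[OF that] \<open>set js = V\<close> by (simp add: V_def)
      show "m \<le> length js" by (simp add: len)
      fix r r'
      have "xs ! r \<in> G" if "r < l" for r using that xs V by (metis l_def nth_mem subsetD)
      then show "(\<Sum>k<m. adj (h k r) * h k r') \<in> S"
        by (cases "r < l"; cases "r' < l") (simp_all add: h_def c S_zero)
    qed
    also have "(\<Sum>r<length js. \<Sum>r'<length js. form (js ! r) (js ! r') (\<Sum>k<m. adj (h k r) * h k r'))
      = (\<Sum>r<l. \<Sum>r'<length js. form (js ! r) (js ! r') (\<Sum>k<m. adj (h k r) * h k r'))"
      by (rule sum.mono_neutral_right) (auto simp: len h_def form_zero)
    also have "\<dots> = (\<Sum>r<l. \<Sum>r'<l. form (js ! r) (js ! r') (\<Sum>k<m. adj (h k r) * h k r'))"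
      by (intro sum.cong refl sum.mono_neutral_right) (auto simp: len h_def form_zero)
    also have "\<dots> = (\<Sum>r<l. \<Sum>r'<l. form (xs ! r) (xs ! r') (?c (xs ! r) (xs ! r')))"
      by (intro sum.cong refl) (auto simp: js_def l_def h_def nth_append)
    also have "\<dots> = (\<Sum>i\<in>V. \<Sum>j\<in>V. form i j (?c i j))"
    proof -
      have "sum f V = (\<Sum>r<l. f (xs ! r))" for f :: "'y \<times> 'v mat \<times> nat \<times> nat \<Rightarrow> complex"
        using sum.reindex_bij_betw[OF bij_betw_nth[OF xs(2), of "{..<l}" V], of f] xs(1)
        by (simp add: l_def)
      then show ?thesis by simp
    qed
    finally show ?thesis using GV by simp
  qed (simp add: GV)
qed

lemma form_extension: "\<exists>T. positive_kernel T \<and> (\<forall>i j. \<forall>a\<in>S. T i j a = form i j a)"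
  by (rule kernel_extension[OF S form_add form_scale form_pos])

section \<open>Matrix unit expansion and linear relations of the scalar form\<close>

lemma form_vector:
  "form i (x *\<^sub>C u + z *\<^sub>C v, W, p', q') a = x * form i (u, W, p', q') a + z * form i (v, W, p', q') a"
  by (cases i) (simp add: form_def valid_def bop_apply_add bop_apply_scaleC cinner_add_left cinner_scaleC_left)

lemma K_entry:
  assumes Z: "Z \<in> \<Omega>" and W: "W \<in> \<Omega>" and P: "P \<in> mats S (dim_row Z) (dim_row W)"
    and p: "p < dim_row Z" "p' < dim_row W"
  shows "cinner (bop_apply (K Z W P $$ (p, p')) u) w
    = (\<Sum>q<dim_row Z. \<Sum>q'<dim_row W. form (w, Z, p, q) (u, W, p', q') (P $$ (q, q')))"
  by (subst graded_linear_entries[OF K_linear[OF Z W] S_zero P p])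
    (simp add: bop_apply_sum cinner_sum_left form_eq Z W p)

text \<open>The intertwining identity at a matrix unit, with the identity matrix on the left side.
  It moves \<beta> from the target coordinate to the argument coordinate, which is why an index
  records both. The transformed matrix unit has scalar entries, so only values at \<open>1\<close>
  occur.\<close>

lemma form_intertwine:
  assumes W: "W \<in> \<Omega>" "W' \<in> \<Omega>" and \<beta>: "\<beta> \<in> carrier_mat (dim_row W') (dim_row W)" "\<beta> *\<^sub>l W = W' *\<^sub>r \<beta>"
    and j: "j < dim_row W'" and q': "q' < dim_row W"
  shows "(\<Sum>p'<dim_row W. cnj (\<beta> $$ (j, p')) * form i (u, W, p', q') 1)
    = (\<Sum>r<dim_row W'. cnj (\<beta> $$ (r, q')) * form i (u, W', j, r) 1)"
proof (cases "valid i")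
  case True
  obtain y Z p q where i: "i = (y, Z, p, q)" by (metis surj_pair)
  have v: "Z \<in> \<Omega>" "p < dim_row Z" "q < dim_row Z" using True by (auto simp: valid_def i)
  let ?n = "dim_row Z" and ?m = "dim_row W" and ?m' = "dim_row W'"
  let ?P = "entry_mat ?n ?m q q' (1::'a)"
  have P: "?P \<in> mats S ?n ?m" by (rule entry_mats[OF S_one])
  have Pc: "?P \<in> carrier_mat ?n ?m" by (simp add: entry_mat_def)
  have "1\<^sub>m ?n *\<^sub>l K Z W ?P *\<^sub>r ctranspose \<beta> = K Z W' (1\<^sub>m ?n *\<^sub>l ?P *\<^sub>r ctranspose \<beta>)"
    by (rule K_intertwine[OF v(1) v(1) one_carrier_mat _ W \<beta> P])
      (simp add: lact_one[OF square[OF v(1)]] ract_one[OF square[OF v(1)]])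
  then have eq: "K Z W ?P *\<^sub>r ctranspose \<beta> = K Z W' (?P *\<^sub>r ctranspose \<beta>)"
    by (simp only: lact_one[OF K_carrier[OF v(1) W(1) P]] lact_one[OF Pc])
  have Q: "(?P *\<^sub>r ctranspose \<beta>) $$ (a, b) = (if a = q then cnj (\<beta> $$ (b, q')) *\<^sub>C 1 else 0)"
    if "a < ?n" "b < ?m'" for a b
  proof -
    have "(?P *\<^sub>r ctranspose \<beta>) $$ (a, b) = (\<Sum>k<?m. cnj (\<beta> $$ (b, k)) *\<^sub>C ?P $$ (a, k))"
      using that \<beta>(1) by (simp add: ract_def ctranspose_def entry_mat_def)
    also have "\<dots> = (\<Sum>k<?m. if k = q' then (if a = q then cnj (\<beta> $$ (b, q')) *\<^sub>C 1 else 0) else 0)"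
      using that by (intro sum.cong refl) (auto simp: entry_mat_def)
    finally show ?thesis using q' by (simp add: sum.delta)
  qed
  have QS: "?P *\<^sub>r ctranspose \<beta> \<in> mats S ?n ?m'"
    using \<beta>(1) Q S_zero S_scale[OF S_one] Pc
    by (auto simp: mats_iff) (auto simp: ract_def ctranspose_def)
  have "(\<Sum>p'<?m. cnj (\<beta> $$ (j, p')) * form i (u, W, p', q') 1)
    = cinner (bop_apply ((K Z W ?P *\<^sub>r ctranspose \<beta>) $$ (p, j)) u) y"
    using \<beta>(1) j v q' K_carrier[OF v(1) W(1) P] W
    by (simp add: ract_def ctranspose_def i form_eq bop_apply_sum cinner_sum_left bop_apply_scale cinner_scaleC_left)
  also have "\<dots> = (\<Sum>a<?n. \<Sum>b<?m'. form (y, Z, p, a) (u, W', j, b) ((?P *\<^sub>r ctranspose \<beta>) $$ (a, b)))"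
    unfolding eq by (rule K_entry[OF v(1) W(2) QS v(2) j])
  also have "\<dots> = (\<Sum>a<?n. if a = q then \<Sum>b<?m'. cnj (\<beta> $$ (b, q')) * form i (u, W', j, b) 1 else 0)"
    by (intro sum.cong refl) (auto simp: Q form_scale[OF S_one] form_zero i)
  finally show ?thesis using v(3) by (simp add: sum.delta)
qed (simp add: form_invalid)

end

section \<open>Operator entries and structure of the extended kernel\<close>

lemma sum_swap3:
  "(\<Sum>a\<in>A. \<Sum>b\<in>B. \<Sum>c\<in>C. f a b c) = (\<Sum>c\<in>C. \<Sum>a\<in>A. \<Sum>b\<in>B. f a b c)"
proof -
  have "(\<Sum>a\<in>A. \<Sum>b\<in>B. \<Sum>c\<in>C. f a b c) = (\<Sum>a\<in>A. \<Sum>c\<in>C. \<Sum>b\<in>B. f a b c)"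
    by (rule sum.cong[OF refl], rule sum.swap)
  then show ?thesis by (simp only: sum.swap[of _ A C])
qed

lemma sum_swap4:
  "(\<Sum>a\<in>A. \<Sum>b\<in>B. \<Sum>c\<in>C. \<Sum>d\<in>D. f a b c d) = (\<Sum>c\<in>C. \<Sum>d\<in>D. \<Sum>a\<in>A. \<Sum>b\<in>B. f a b c d)"
  by (rule trans[OF sum_swap3], rule sum.cong[OF refl], rule sum_swap3)

locale extended_kernel = cp_kernel \<Omega> S K + positive_kernel T
  for \<Omega> :: "'v::complex_vector mat set" and S :: "'a::unital_cstar_algebra set"
    and K :: "'v mat \<Rightarrow> 'v mat \<Rightarrow> 'a mat \<Rightarrow> 'y::chilbert_space bop mat"
    and T :: "'y \<times> 'v mat \<times> nat \<times> nat \<Rightarrow> 'y \<times> 'v mat \<times> nat \<times> nat \<Rightarrow> 'a \<Rightarrow> complex" +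
  assumes T_form: "a \<in> S \<Longrightarrow> T i j a = form i j a"
begin

text \<open>Linearity in the vector is one relation between three columns, true at \<open>1\<close>
  because the entries of \<open>K\<close> are linear operators. The one-point set and the booleans
  enumerate the terms of its two sides.\<close>

lemma T_vector_right:
  "T i (x *\<^sub>C u + z *\<^sub>C v, W, p', q') a = x * T i (u, W, p', q') a + z * T i (v, W, p', q') a"
  using T_relation[where A = "{()}" and B = UNIV and c = "\<lambda>_. 1" and \<iota> = "\<lambda>_. (x *\<^sub>C u + z *\<^sub>C v, W, p', q')"
      and d = "\<lambda>b. if b then x else z" and \<kappa> = "\<lambda>b. (if b then u else v, W, p', q')" and i = i and a = a]
  by (simp add: T_form S_one form_vector UNIV_bool add.commute)

lemma T_vector_left:
  "T (x *\<^sub>C u + z *\<^sub>C v, W, p', q') i a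
    = cnj x * T (u, W, p', q') i a + cnj z * T (v, W, p', q') i a"
  using T_relation_left[where A = "{()}" and B = UNIV and c = "\<lambda>_. 1" and \<iota> = "\<lambda>_. (x *\<^sub>C u + z *\<^sub>C v, W, p', q')"
      and d = "\<lambda>b. if b then x else z" and \<kappa> = "\<lambda>b. (if b then u else v, W, p', q')" and i = i and a = a]
  by (simp add: T_vector_right UNIV_bool add.commute)

lemma T_intertwine_right:
  assumes "W \<in> \<Omega>" "W' \<in> \<Omega>" "\<beta> \<in> carrier_mat (dim_row W') (dim_row W)" "\<beta> *\<^sub>l W = W' *\<^sub>r \<beta>"
    and "j < dim_row W'" and "q' < dim_row W"
  shows "(\<Sum>p'<dim_row W. cnj (\<beta> $$ (j, p')) * T i (u, W, p', q') a)
    = (\<Sum>r<dim_row W'. cnj (\<beta> $$ (r, q')) * T i (u, W', j, r) a)"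
  by (rule T_relation) (simp_all add: T_form S_one form_intertwine[OF assms])

lemma T_intertwine_left:
  assumes "W \<in> \<Omega>" "W' \<in> \<Omega>" "\<beta> \<in> carrier_mat (dim_row W') (dim_row W)" "\<beta> *\<^sub>l W = W' *\<^sub>r \<beta>"
    and "j < dim_row W'" and "q' < dim_row W"
  shows "(\<Sum>p'<dim_row W. \<beta> $$ (j, p') * T (u, W, p', q') i a)
    = (\<Sum>r<dim_row W'. \<beta> $$ (r, q') * T (u, W', j, r) i a)"
  using T_relation_left[OF T_intertwine_right[OF assms]] by simp

text \<open>At \<open>1\<close> the diagonal value is the quadratic form of an entry of
  \<open>K\<close>, or \<open>0\<close> for an invalid index; the sign of \<open>C\<close> covers
  the latter.\<close>

lemma T_diagonal_bound: "\<exists>C\<ge>0. \<forall>w. Re (T (w, Z, p, q) (w, Z, p, q) 1) \<le> C * (norm w)\<^sup>2"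
proof -
  obtain C where C: "0 \<le> C" "\<And>w. cmod (cinner (bop_apply
      (K Z Z (entry_mat (dim_row Z) (dim_row Z) q q 1) $$ (p, p)) w) w) \<le> C * (norm w)\<^sup>2"
    using bop_form_bound by blast
  have "Re (T (w, Z, p, q) (w, Z, p, q) 1) \<le> C * (norm w)\<^sup>2" for w
    using order_trans[OF complex_Re_le_cmod C(2)[of w]] C(1)
    by (simp add: T_form S_one form_def)
  then show ?thesis using C(1) by blast
qed

lemma T_vector_bound: "\<exists>C. \<forall>u w. cmod (T (w, Z, p, q) (u, W, p', q') a) \<le> C * norm u * norm w"
proof -
  obtain t where t: "0 \<le> t" "\<And>i j. (cmod (T i j a))\<^sup>2 \<le> t * Re (T i i 1) * Re (T j j 1)"
    using T_bound by blast
  obtain C where C: "0 \<le> C" "\<And>w. Re (T (w, Z, p, q) (w, Z, p, q) 1) \<le> C * (norm w)\<^sup>2"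
    using T_diagonal_bound by blast
  obtain D where D: "0 \<le> D" "\<And>u. Re (T (u, W, p', q') (u, W, p', q') 1) \<le> D * (norm u)\<^sup>2"
    using T_diagonal_bound by blast
  have "cmod (T (w, Z, p, q) (u, W, p', q') a) \<le> sqrt (t * C * D) * norm u * norm w" for u w
  proof (rule power2_le_imp_le)
    let ?i = "(w, Z, p, q)" and ?j = "(u, W, p', q')"
    have pos: "0 \<le> Re (T j j 1)" for j
      using T_pos[where G = "{j}" and m = "Suc 0" and g = "\<lambda>_ _. 1"]
      by (simp add: lessThan_Suc complex_nonneg_Reals_iff)
    have "(cmod (T ?i ?j a))\<^sup>2 \<le> t * Re (T ?i ?i 1) * Re (T ?j ?j 1)" by (rule t)
    also have "\<dots> \<le> t * (C * (norm w)\<^sup>2) * (D * (norm u)\<^sup>2)"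
      by (intro mult_mono C D pos t(1) mult_nonneg_nonneg order_refl) simp_all
    also have "\<dots> = (sqrt (t * C * D) * norm u * norm w)\<^sup>2"
      using t(1) C(1) D(1) by (simp add: power_mult_distrib)
    finally show "(cmod (T ?i ?j a))\<^sup>2 \<le> (sqrt (t * C * D) * norm u * norm w)\<^sup>2" .
    show "0 \<le> sqrt (t * C * D) * norm u * norm w" using t(1) C(1) D(1) by simp
  qed
  then show ?thesis by blast
qed

text \<open>The chosen operator is determined by its sesquilinear form. The double sum reassembles
  the argument from its matrix units, as \<open>K_entry\<close> does for \<open>K\<close>.\<close>

definition extension :: "'v mat \<Rightarrow> 'v mat \<Rightarrow> 'a mat \<Rightarrow> 'y bop mat" where
  "extension Z W P = mat (dim_row Z) (dim_row W) (\<lambda>(p, p'). SOME A. \<forall>u w. cinner (bop_apply A u) w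
     = (\<Sum>q<dim_row Z. \<Sum>q'<dim_row W. T (w, Z, p, q) (u, W, p', q') (P $$ (q, q'))))"

lemma extension_carrier: "extension Z W P \<in> carrier_mat (dim_row Z) (dim_row W)"
  by (simp add: extension_def)

lemma extension_dim [simp]: "dim_row (extension Z W P) = dim_row Z" "dim_col (extension Z W P) = dim_row W"
  by (simp_all add: extension_def)

lemma extension_entry:
  assumes "p < dim_row Z" "p' < dim_row W"
  shows "cinner (bop_apply (extension Z W P $$ (p, p')) u) w
    = (\<Sum>q<dim_row Z. \<Sum>q'<dim_row W. T (w, Z, p, q) (u, W, p', q') (P $$ (q, q')))"
proof -
  let ?B = "\<lambda>u w. \<Sum>q<dim_row Z. \<Sum>q'<dim_row W. T (w, Z, p, q) (u, W, p', q') (P $$ (q, q'))"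
  have "\<forall>q q'. \<exists>C. \<forall>u w. cmod (T (w, Z, p, q) (u, W, p', q') (P $$ (q, q'))) \<le> C * norm u * norm w"
    using T_vector_bound by blast
  then obtain C where C: "\<And>q q' u w. cmod (T (w, Z, p, q) (u, W, p', q') (P $$ (q, q')))
      \<le> C q q' * norm u * norm w"
    by metis
  have right: "T i (u + v, W, p', q') a = T i (u, W, p', q') a + T i (v, W, p', q') a"
      "T i (c *\<^sub>C u, W, p', q') a = c * T i (u, W, p', q') a" for i u v c q' a
    using T_vector_right[of i 1 u 1 v W p' q' a] T_vector_right[of i c u 0 u W p' q' a]
    by (simp_all add: scaleC_one)
  have left: "T (u + v, Z, p, q) i a = T (u, Z, p, q) i a + T (v, Z, p, q) i a"
      "T (c *\<^sub>C u, Z, p, q) i a = cnj c * T (u, Z, p, q) i a" for i u v c q a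
    using T_vector_left[of 1 u 1 v Z p q i a] T_vector_left[of c u 0 u Z p q i a]
    by (simp_all add: scaleC_one)
  have "\<exists>A. \<forall>u w. cinner (bop_apply A u) w = ?B u w"
  proof (rule sesquilinear_form_bop[where C = "\<Sum>q<dim_row Z. \<Sum>q'<dim_row W. C q q'"])
    fix u w
    have "cmod (?B u w) \<le> (\<Sum>q<dim_row Z. \<Sum>q'<dim_row W. C q q' * norm u * norm w)"
      by (intro sum_norm_le C)
    then show "cmod (?B u w) \<le> (\<Sum>q<dim_row Z. \<Sum>q'<dim_row W. C q q') * norm u * norm w"
      by (simp add: sum_distrib_right)
  qed (simp_all add: right left sum.distrib sum_distrib_left)
  from someI_ex[OF this] show ?thesis using assms by (simp add: extension_def)
qed

lemma extension_extends:
  assumes "Z \<in> \<Omega>" "W \<in> \<Omega>" and P: "P \<in> mats S (dim_row Z) (dim_row W)"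
  shows "extension Z W P = K Z W P"
proof (rule eq_matI)
  fix p p' assume "p < dim_row (K Z W P)" "p' < dim_col (K Z W P)"
  then have p: "p < dim_row Z" "p' < dim_row W" using K_carrier[OF assms] by auto
  show "extension Z W P $$ (p, p') = K Z W P $$ (p, p')"
  proof (rule bop_eqI)
    fix u w
    show "cinner (bop_apply (extension Z W P $$ (p, p')) u) w = cinner (bop_apply (K Z W P $$ (p, p')) u) w"
      unfolding extension_entry[OF p] K_entry[OF assms p]
      using P by (intro sum.cong refl T_form) (simp add: mats_iff)
  qed
qed (use K_carrier[OF assms] in \<open>auto simp: extension_def\<close>)

lemma extension_linear: "graded_linear UNIV (dim_row Z) (dim_row W) (extension Z W)"
  unfolding graded_linear_def
proof (intro conjI ballI allI)
  fix P Q :: "'a mat" and c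
  let ?n = "dim_row Z" and ?m = "dim_row W"
  show "extension Z W P \<in> carrier_mat ?n ?m" by (rule extension_carrier)
  assume P: "P \<in> mats UNIV ?n ?m"
  show "extension Z W (map_mat (scaleC c) P) = map_mat (scaleC c) (extension Z W P)"
    by (rule eq_matI, rule bop_eqI)
      (use P in \<open>auto simp: mats_iff extension_entry bop_apply_scale
        cinner_scaleC_left T_scale sum_distrib_left\<close>)
  assume Q: "Q \<in> mats UNIV ?n ?m"
  show "extension Z W (P + Q) = extension Z W P + extension Z W Q"
    by (rule eq_matI, rule bop_eqI)
      (use P Q in \<open>auto simp: mats_iff extension_entry bop_apply_plus
        cinner_add_left T_add sum.distrib\<close>)
qed

text \<open>The left relation carries \<alpha> and the right relation carries \<beta> from the
  target coordinates to the argument coordinates, where linearity of \<open>T\<close> absorbs them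
  into the matrix argument. The remaining steps reorder sums.\<close>

lemma extension_intertwine:
  assumes Z: "Z \<in> \<Omega>" "Z' \<in> \<Omega>" and \<alpha>: "\<alpha> \<in> carrier_mat (dim_row Z') (dim_row Z)" "\<alpha> *\<^sub>l Z = Z' *\<^sub>r \<alpha>"
    and W: "W \<in> \<Omega>" "W' \<in> \<Omega>" and \<beta>: "\<beta> \<in> carrier_mat (dim_row W') (dim_row W)" "\<beta> *\<^sub>l W = W' *\<^sub>r \<beta>"
    and P: "P \<in> carrier_mat (dim_row Z) (dim_row W)"
  shows "\<alpha> *\<^sub>l extension Z W P *\<^sub>r ctranspose \<beta> = extension Z' W' (\<alpha> *\<^sub>l P *\<^sub>r ctranspose \<beta>)"
proof (rule eq_matI)
  let ?n = "dim_row Z" and ?n' = "dim_row Z'" and ?m = "dim_row W" and ?m' = "dim_row W'"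
  fix i j assume "i < dim_row (extension Z' W' (\<alpha> *\<^sub>l P *\<^sub>r ctranspose \<beta>))"
    "j < dim_col (extension Z' W' (\<alpha> *\<^sub>l P *\<^sub>r ctranspose \<beta>))"
  then have ij: "i < ?n'" "j < ?m'" by (auto simp: extension_def)
  have entry: "(\<alpha> *\<^sub>l Q *\<^sub>r ctranspose \<beta>) $$ (a, b)
      = (\<Sum>p'<?m. \<Sum>p<?n. (cnj (\<beta> $$ (b, p')) * \<alpha> $$ (a, p)) *\<^sub>C Q $$ (p, p'))"
    if "Q \<in> carrier_mat ?n ?m" "a < ?n'" "b < ?m'" for a b and Q :: "'z::complex_vector mat"
    using that \<alpha>(1) \<beta>(1) by (simp add: lact_def ract_def ctranspose_def scaleC_sum_right scaleC_scaleC)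
  show "(\<alpha> *\<^sub>l extension Z W P *\<^sub>r ctranspose \<beta>) $$ (i, j)
      = extension Z' W' (\<alpha> *\<^sub>l P *\<^sub>r ctranspose \<beta>) $$ (i, j)"
  proof (rule bop_eqI)
    fix u w
    let ?t = "\<lambda>X Y p q p' q'. T (w, X, p, q) (u, Y, p', q')"
    have "cinner (bop_apply ((\<alpha> *\<^sub>l extension Z W P *\<^sub>r ctranspose \<beta>) $$ (i, j)) u) w
      = (\<Sum>p'<?m. \<Sum>p<?n. \<Sum>q<?n. \<Sum>q'<?m.
          cnj (\<beta> $$ (j, p')) * (\<alpha> $$ (i, p) * ?t Z W p q p' q' (P $$ (q, q'))))"
      using ij by (simp add: entry extension_carrier bop_apply_sum cinner_sum_left bop_apply_scale
          cinner_scaleC_left extension_entry sum_distrib_left mult.assoc)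
    also have "\<dots> = (\<Sum>q<?n. \<Sum>q'<?m. \<Sum>p'<?m. cnj (\<beta> $$ (j, p')) *
          (\<Sum>p<?n. \<alpha> $$ (i, p) * ?t Z W p q p' q' (P $$ (q, q'))))"
      unfolding sum_distrib_left
      by (rule sum_swap4)
    \<comment> \<open>The sum over target rows \<open>p\<close> of \<open>Z\<close> is traded for
      one over argument rows \<open>r\<close> of \<open>Z'\<close>, with target row \<open>i\<close>
      fixed.\<close>
    also have "\<dots> = (\<Sum>q<?n. \<Sum>q'<?m. \<Sum>p'<?m. cnj (\<beta> $$ (j, p')) *
          (\<Sum>r<?n'. \<alpha> $$ (r, q) * ?t Z' W i r p' q' (P $$ (q, q'))))"
      by (intro sum.cong refl arg_cong[where f = "(*) _"] T_intertwine_left[OF Z \<alpha> ij(1)]) simp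
    also have "\<dots> = (\<Sum>q<?n. \<Sum>q'<?m. \<Sum>r<?n'. \<alpha> $$ (r, q) *
          (\<Sum>p'<?m. cnj (\<beta> $$ (j, p')) * ?t Z' W i r p' q' (P $$ (q, q'))))"
      unfolding sum_distrib_left
      by (rule sum.cong[OF refl], rule sum.cong[OF refl], subst sum.swap) (simp add: mult_ac)
    \<comment> \<open>The same exchange on the column side, with target column \<open>j\<close>
      fixed.\<close>
    also have "\<dots> = (\<Sum>q<?n. \<Sum>q'<?m. \<Sum>r<?n'. \<alpha> $$ (r, q) *
          (\<Sum>r'<?m'. cnj (\<beta> $$ (r', q')) * ?t Z' W' i r j r' (P $$ (q, q'))))"
      by (intro sum.cong refl arg_cong[where f = "(*) _"] T_intertwine_right[OF W \<beta> ij(2)]) simp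
    also have "\<dots> = (\<Sum>r<?n'. \<Sum>r'<?m'. \<Sum>q'<?m. \<Sum>q<?n.
          cnj (\<beta> $$ (r', q')) * \<alpha> $$ (r, q) * ?t Z' W' i r j r' (P $$ (q, q')))"
      unfolding sum_distrib_left
      by (rule trans[OF sum_swap4], rule sum.cong[OF refl], rule sum.cong[OF refl], subst sum.swap)
        (simp add: mult_ac)
    also have "\<dots> = (\<Sum>r<?n'. \<Sum>r'<?m'. ?t Z' W' i r j r' ((\<alpha> *\<^sub>l P *\<^sub>r ctranspose \<beta>) $$ (r, r')))"
      by (intro sum.cong refl) (simp add: entry[OF P] T_sum T_scale)
    also have "\<dots> = cinner (bop_apply (extension Z' W' (\<alpha> *\<^sub>l P *\<^sub>r ctranspose \<beta>) $$ (i, j)) u) w"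
      by (rule extension_entry[OF ij, symmetric])
    finally show "cinner (bop_apply ((\<alpha> *\<^sub>l extension Z W P *\<^sub>r ctranspose \<beta>) $$ (i, j)) u) w = \<dots>" .
  qed
qed (use \<alpha>(1) \<beta>(1) in \<open>auto simp: lact_def ract_def ctranspose_def extension_def\<close>)

text \<open>Once the ampliation and the blocks are unfolded, the quadratic form is a double sum of
  \<open>T\<close> over pairs \<open>(a, q)\<close> of a target row and an argument coordinate in
  its block, with Gram coefficients inherited from \<open>P\<close>.\<close>

lemma extension_cp:
  assumes Zs: "set Zs \<subseteq> \<Omega>"
  shows "cp_map UNIV (sum_list (map dim_row Zs)) (blockwise (map dim_row Zs) (\<lambda>i j. extension (Zs ! i) (Zs ! j)))"
  unfolding cp_map_def
proof (intro allI ballI impI)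
  define ns where "ns = map dim_row Zs"
  define N where "N = sum_list ns"
  fix k :: nat and P :: "'a mat"
  let ?\<phi> = "blockwise ns (\<lambda>i j. extension (Zs ! i) (Zs ! j))"
  let ?R = "replicate k N"
  let ?M = "k * N"
  assume "pos_alg_mat (k * sum_list (map dim_row Zs)) P"
  then have "pos_alg_mat ?M P" by (simp add: N_def ns_def)
  then obtain g where P: "\<And>a b. a < ?M \<Longrightarrow> b < ?M \<Longrightarrow> P $$ (a, b) = (\<Sum>l<?M. adj (g l a) * g l b)"
    by (rule pos_alg_matE) (rule that)
  define c where "c a = block_pos ?R a" for a
  define r where "r a = block_index ns (c a)" for a
  define p where "p a = block_pos ns (c a)" for a
  \<comment> \<open>\<open>x a q\<close> is the row of \<open>P\<close> at coordinate
    \<open>q\<close> in the outer copy and the inner block containing row \<open>a\<close>.\<close>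
  define x where "x a q = offset ?R (block_index ?R a) + (offset ns (r a) + q)" for a q
  have R: "sum_list ?R = ?M" by (simp add: sum_list_replicate)
  have idx: "block_index ?R a < k" "c a < N" "r a < length Zs" "p a < ns ! r a"
    "q < ns ! r a \<Longrightarrow> offset ns (r a) + q < N" "q < ns ! r a \<Longrightarrow> x a q < ?M" if "a < ?M" for a q
  proof -
    have a: "a < sum_list ?R" using that R by simp
    show bi: "block_index ?R a < k" using block_index_less[OF a] by simp
    show c: "c a < N" using block_pos_less[OF a] bi by (simp add: c_def)
    then have c': "c a < sum_list ns" by (simp add: N_def)
    show r: "r a < length Zs" using block_index_less[OF c'] by (simp add: r_def ns_def)
    show "p a < ns ! r a" using block_pos_less[OF c'] by (simp add: r_def p_def)
    show "offset ns (r a) + q < N" if "q < ns ! r a"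
      using offset_add_less[of "r a" ns q] r that by (simp add: N_def ns_def)
    then show "x a q < ?M" if "q < ns ! r a"
      using offset_add_less[of "block_index ?R a" ?R "offset ns (r a) + q"] that bi R by (simp add: x_def)
  qed
  define Q where "Q a b = block ns (block ?R P (block_index ?R a) (block_index ?R b)) (r a) (r b)" for a b
  have Q: "Q a b $$ (q, q') = P $$ (x a q, x b q')"
    if "a < ?M" "b < ?M" "q < ns ! r a" "q' < ns ! r b" for a b q q'
    using that idx[OF that(1)] idx[OF that(2)] by (simp add: Q_def block_def x_def)
  define \<Phi> where "\<Phi> = blockwise ?R (\<lambda>_ _. ?\<phi>) P"
  have \<Phi>: "\<Phi> $$ (a, b) = extension (Zs ! r a) (Zs ! r b) (Q a b) $$ (p a, p b)" if "a < ?M" "b < ?M" for a b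
    using that idx(2)[OF that(1)] idx(2)[OF that(2)]
    by (simp add: \<Phi>_def blockwise_def[of ?R] R Let_def c_def[symmetric])
      (simp add: blockwise_def N_def[symmetric] Let_def Q_def r_def p_def)
  have "pos_op_mat ?M \<Phi>"
    unfolding pos_op_mat_def
  proof (intro conjI ballI)
    show "\<Phi> \<in> carrier_mat ?M ?M" by (simp add: \<Phi>_def blockwise_def R)
    fix y :: "'y vec" assume "y \<in> carrier_vec ?M"
    define I where "I = Sigma {..<?M} (\<lambda>a. {..<ns ! r a})"
    \<comment> \<open>Distinct pairs may yield the same index, for instance in different outer
      copies; hence positivity for families.\<close>
    define \<iota> where "\<iota> s = (y $ fst s, Zs ! r (fst s), p (fst s), snd s)" for s :: "nat \<times> nat"
    have sum_I: "(\<Sum>a<?M. \<Sum>q<ns ! r a. h a q) = (\<Sum>s\<in>I. h (fst s) (snd s))"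
      for h :: "nat \<Rightarrow> nat \<Rightarrow> complex"
      by (simp add: I_def sum.Sigma split_beta)
    have "cinner (bop_apply (\<Phi> $$ (a, b)) (y $ b)) (y $ a)
      = (\<Sum>q<ns ! r a. \<Sum>q'<ns ! r b. T (\<iota> (a, q)) (\<iota> (b, q')) (\<Sum>l<?M. adj (g l (x a q)) * g l (x b q')))"
      if ab: "a < ?M" "b < ?M" for a b
    proof -
      have d: "dim_row (Zs ! r a) = ns ! r a" "dim_row (Zs ! r b) = ns ! r b"
        using idx(3) ab by (simp_all add: ns_def)
      then show ?thesis
        using idx[OF ab(1)] idx[OF ab(2)] ab by (simp add: \<Phi> extension_entry Q P \<iota>_def)
    qed
    then have "(\<Sum>a<?M. cinner (\<Sum>b<?M. bop_apply (\<Phi> $$ (a, b)) (y $ b)) (y $ a))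
      = (\<Sum>a<?M. \<Sum>b<?M. \<Sum>q<ns ! r a. \<Sum>q'<ns ! r b.
          T (\<iota> (a, q)) (\<iota> (b, q')) (\<Sum>l<?M. adj (g l (x a q)) * g l (x b q')))"
      by (simp add: cinner_sum_left)
    also have "\<dots> = (\<Sum>a<?M. \<Sum>q<ns ! r a. \<Sum>b<?M. \<Sum>q'<ns ! r b.
          T (\<iota> (a, q)) (\<iota> (b, q')) (\<Sum>l<?M. adj (g l (x a q)) * g l (x b q')))"
      by (rule sum.cong[OF refl], rule sum.swap)
    also have "\<dots> = (\<Sum>s\<in>I. \<Sum>s'\<in>I.
          T (\<iota> s) (\<iota> s') (\<Sum>l<?M. adj (g l (x (fst s) (snd s))) * g l (x (fst s') (snd s'))))"
      by (simp only: sum_I prod.collapse)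
    also have "\<dots> \<in> \<real>\<^sub>\<ge>\<^sub>0"
      by (rule T_pos_family) (simp add: I_def)
    finally show "(\<Sum>a<?M. cinner (\<Sum>b<?M. bop_apply (\<Phi> $$ (a, b)) (y $ b)) (y $ a)) \<in> \<real>\<^sub>\<ge>\<^sub>0" .
  qed
  then show "pos_op_mat (k * sum_list (map dim_row Zs)) (blockwise (replicate k (sum_list (map dim_row Zs)))
      (\<lambda>_ _. blockwise (map dim_row Zs) (\<lambda>i j. extension (Zs ! i) (Zs ! j))) P)"
    by (simp add: \<Phi>_def N_def ns_def)
qed

lemma extension_cp_nc_kernel: "cp_nc_kernel \<Omega> UNIV extension"
  unfolding cp_nc_kernel_def nc_kernel_def
  by (auto simp: mats_iff intro!: extension_linear extension_intertwine extension_cp)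

end

theorem theorem4p1:
  fixes \<Omega> :: "'v::complex_vector mat set"
    and S :: "'a::unital_cstar_algebra set"
    and K :: "'v mat \<Rightarrow> 'v mat \<Rightarrow> 'a mat \<Rightarrow> 'y::chilbert_space bop mat"
  assumes "finite \<Omega>" and "\<Omega> \<subseteq> nc_space"
    and "operator_system S"
    and "cp_nc_kernel \<Omega> S K"
  shows "\<exists>K' :: 'v mat \<Rightarrow> 'v mat \<Rightarrow> 'a mat \<Rightarrow> 'y bop mat.
    cp_nc_kernel \<Omega> UNIV K' \<and>
    (\<forall>Z\<in>\<Omega>. \<forall>W\<in>\<Omega>. \<forall>P \<in> mats S (dim_row Z) (dim_row W). K' Z W P = K Z W P)"
proof -
  interpret cp_kernel \<Omega> S K by unfold_locales (use assms in auto)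
  obtain T where "positive_kernel T" and T: "\<And>i j a. a \<in> S \<Longrightarrow> T i j a = form i j a"
    using form_extension by blast
  then interpret positive_kernel T by simp
  interpret extended_kernel \<Omega> S K T by unfold_locales (rule T)
  show ?thesis using extension_cp_nc_kernel extension_extends by blast
qed

end
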